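(* Let $d,D\in\mathbb N^+\cup\{+\infty\}$, $p,q>0$, and let $K:\mathbb T^d\to\mathbb R^D$ be analytic, with Fourier coefficients $\widehat K(s)$. For almost all rotations $\rho\in\mathbb T^d$ the following holds. Suppose $F:\Omega\to\Omega$, $\Omega\subset\mathbb R^D$, is a diffeomorphism with an invariant set $\Gamma=K(\mathbb T^d)\subset\Omega$ satisfying the conjugation $$F(K(\theta))=K(\theta+\rho),\qquad\theta\in\mathbb T^d,$$ and for $\theta_0\in\mathbb T^d$ put $p_0=K(\theta_0)$ and $p_n=F^n(p_0)=K(\theta_0+n\rho)$, $n\in\mathbb N$. For $s\in\mathbb Z^d$ (for $s\in\mathbb Z_*^\infty$ if $d=\infty$) define $$E_N(s,\theta_0)=\Big\|\widehat K(s)-\exp(-2\pi i\langle s,\theta_0\rangle)\cdot\frac1{A_N^{p,q}}\sum_{n=1}^{N-1}w_{p,q}(n/N)\,p_n\exp(-2\pi i n\langle s,\rho\rangle)\Big\|_{\ell^\infty}.$$ Then for each fixed $s$, $E_N(s,\theta_0)=o(1)$ as $N\to+\infty$, uniformly in $\theta_0\in\mathbb T^d$. Moreover: (I) (Finite-dimensional case, $d\in\mathbb N^+$.) $E_N(s,\theta_0)=\mathcal O(\exp(-N^{\zeta_6}))$ for any $0<\zeta_6<(d+1+1/\min\{p,q\})^{-1}$. In particular, this holds uniformly in $\|s\|_{\ell^1}=o(N^{\zeta_6})$. (II) (Infinite-dimensional case, $d=\infty$.) $E_N(s,\theta_0)=\mathcal O(\exp(-(\log N)^{\zeta_7}))$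 for any $2\le\zeta_7<1+\eta$, where $2\le\eta\in\mathbb N^+$ is the fixed integer of the spatial structure. In particular, this holds uniformly in $|s|_\eta=o((\log N)^{\zeta_7})$. Here "uniformly in $\|s\|_{\ell^1}=o(N^{\zeta_6})$" (resp. $|s|_\eta=o((\log N)^{\zeta_7})$) means that for every nonnegative sequence $S_N=o(N^{\zeta_6})$ (resp. $S_N=o((\log N)^{\zeta_7})$), the bound holds with one implied constant for all $s$ with $\|s\|_{\ell^1}\le S_N$ (resp. $|s|_\eta\le S_N$).
   Context: Weighting function. For $p,q>0$, $$w_{p,q}(x)=\Big(\int_0^1\exp(-s^{-p}(1-s)^{-q})\,ds\Big)^{-1}\exp\big(-x^{-p}(1-x)^{-q}\big)\ (x\in(0,1)),\qquad w_{p,q}(x)=0\ (x\notin(0,1)),$$ and $A_N^{p,q}=\sum_{n=0}^{N-1}w_{p,q}(n/N)$, with $N\ge2$. $\mathbb T^d=\mathbb R^d/\mathbb Z^d$; $\|\cdot\|_{\ell^\infty}$ is the supremum of the absolute values of the components of a vector (with $D$ components, possibly $D=\infty$). Finite-dimensional case, $d\in\mathbb N^+$. $\|k\|_{\ell^1}=\sum_{j=1}^d|k_j|$, $\langle k,x\rangle=\sum_jk_jx_j$. For $\sigma>0$, $\mathbb T^d_\sigma=\{x=(x_j)_{1\le j\le d}:x_j\in\mathbb C,\ \mathrm{Re}\,x_j\in\mathbb T^1,\ |\mathrm{Im}\,x_j|\le\sigma\}$. $K$ is analytic on $\mathbb T^d$ if for some $\sigma>0$ it extends to $\mathbb T_\sigma^d$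 with $K(x)=\sum_{k\in\mathbb Z^d}\widehat K(k)\exp(2\pi i\langle k,x\rangle)$ and $\sum_{k\in\mathbb Z^d}\|\widehat K(k)\|_{\ell^\infty}\exp(2\pi\sigma\|k\|_{\ell^1})<+\infty$. "Almost all $\rho$" refers to Lebesgue measure. Infinite-dimensional case, $d=\infty$. The index set is $J=\mathbb N$ or $J=\mathbb Z$, with $\mathbb T^\infty=\mathbb T^J$ and $\mathbb Z^\infty=\mathbb Z^J$. Fix an integer $\eta\ge2$; $\langle j\rangle=\max\{1,|j|\}$, $|k|_\eta=\sum_{j\in J}\langle j\rangle^\eta|k_j|$, $\mathbb Z_*^\infty=\{k\in\mathbb Z^\infty:|k|_\eta<+\infty\}$, $\langle k,x\rangle=\sum_{j\in J}k_jx_j$. For $\sigma>0$, $\mathbb T_\sigma^\infty=\{x=(x_j)_{j\in J}:x_j\in\mathbb C,\ \mathrm{Re}\,x_j\in\mathbb T^1,\ |\mathrm{Im}\,x_j|\le\sigma\langle j\rangle^\eta\}$. $K$ is analytic on $\mathbb T^\infty$ if for some $\sigma>0$ it extends to $\mathbb T_\sigma^\infty$ with $K(x)=\sum_{k\in\mathbb Z_*^\infty}\widehat K(k)\exp(2\pi i\langle k,x\rangle)$ and $\sum_{k\in\mathbb Z_*^\infty}\|\widehat K(k)\|_{\ell^\infty}\exp(2\pi\sigma|k|_\eta)<+\infty$. "Almost all $\rho$" means full probability measure with respect to the product measure on $\mathbb T^\infty$ (identified with the cube $[1,2]^\infty$). In both cases $\widehat K(s)=\int_{\mathbb T^d}K(x)\exp(-2\pi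 i\langle s,x\rangle)\,dx$, where for $d=\infty$ the integral is the limit, as the number of variables tends to infinity, of the integrals over finitely many variables. Implied constants do not depend on $N$ or $\theta_0$. *)

theory Defs
  imports "HOL-Probability.Probability" "HOL-Library.Landau_Symbols"
begin

definition bump :: "real \<Rightarrow> real \<Rightarrow> real \<Rightarrow> real" where
  "bump p q x = exp (- (x powr (- p) * (1 - x) powr (- q)))"

definition weight :: "real \<Rightarrow> real \<Rightarrow> real \<Rightarrow> real" where
  "weight p q x =
     (if 0 < x \<and> x < 1 then inverse (LBINT s:{0<..<1}. bump p q s) * bump p q x else 0)"

definition weight_total :: "real \<Rightarrow> real \<Rightarrow> nat \<Rightarrow> real" where
  "weight_total p q N = (\<Sum>n<N. weight p q (real n / real N))"

text \<open>
  A vector with \<open>D\<close> components is a function on an index type. The types of class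
  \<open>countable\<close> are, up to bijection, exactly the index sets of size \<open>1, 2, 3, \<dots>, \<infinity>\<close>.
  The supremum norm takes values in \<^typ>\<open>ennreal\<close>, so that it is \<open>\<infinity>\<close> on unbounded
  vectors.
\<close>

definition linf :: "('i \<Rightarrow> 'v::real_normed_vector) \<Rightarrow> ennreal" where
  "linf v = (SUP i. ennreal (norm (v i)))"

text \<open>
  Differentiability relative to a set, and diffeomorphisms, with respect to the supremum norm.
  For a finite index type this is Frechet differentiability within \<open>S\<close> in the sense of
  \<open>differentiable_on\<close>. For an infinite index type increments of infinite norm are
  irrelevant, and the derivative is a bounded linear operator on the space of bounded
  sequences. The domain is not required to be open.
\<close>

definition linf_bounded_linear :: "(('i \<Rightarrow> real) \<Rightarrow> ('i \<Rightarrow> real)) \<Rightarrow> bool" where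
  "linf_bounded_linear L \<longleftrightarrow>
     (\<forall>u v. linf u < \<infinity> \<and> linf v < \<infinity> \<longrightarrow> L (\<lambda>i. u i + v i) = (\<lambda>i. L u i + L v i)) \<and>
     (\<forall>c u. linf u < \<infinity> \<longrightarrow> L (\<lambda>i. c * u i) = (\<lambda>i. c * L u i)) \<and>
     (\<exists>B::real. \<forall>u. linf u < \<infinity> \<longrightarrow> linf (L u) \<le> ennreal B * linf u)"

definition linf_differentiable_on ::
    "(('i \<Rightarrow> real) \<Rightarrow> ('i \<Rightarrow> real)) \<Rightarrow> ('i \<Rightarrow> real) set \<Rightarrow> bool" where
  "linf_differentiable_on f S \<longleftrightarrow>
     (\<forall>x\<in>S. \<exists>L. linf_bounded_linear L \<and>
        (\<forall>\<epsilon>::real. \<epsilon> > 0 \<longrightarrow> (\<exists>\<delta>::real. \<delta> > 0 \<and> (\<forall>y\<in>S. linf (\<lambda>i. y i - x i) < ennreal \<delta> \<longrightarrow>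
           linf (\<lambda>i. f y i - f x i - L (\<lambda>j. y j - x j) i)
             \<le> ennreal \<epsilon> * linf (\<lambda>i. y i - x i)))))"

definition diffeomorphism_of ::
    "('i \<Rightarrow> real) set \<Rightarrow> (('i \<Rightarrow> real) \<Rightarrow> ('i \<Rightarrow> real)) \<Rightarrow> bool" where
  "diffeomorphism_of \<Omega> F \<longleftrightarrow>
     bij_betw F \<Omega> \<Omega> \<and> linf_differentiable_on F \<Omega> \<and>
     linf_differentiable_on (inv_into \<Omega> F) \<Omega>"

text \<open>
  All coordinates are indexed by a set \<open>J\<close> of integers. A point of the torus is represented
  by any real lift, that is by a function whose values on \<open>J\<close> are taken modulo 1 and whose
  values off \<open>J\<close> are irrelevant.
\<close>

definition torus_index :: "enat \<Rightarrow> int set \<Rightarrow> bool" where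
  "torus_index d J \<longleftrightarrow>
     (case d of enat m \<Rightarrow> 1 \<le> m \<and> J = {1..int m} | \<infinity> \<Rightarrow> J = {0..} \<or> J = UNIV)"

definition torus_map :: "int set \<Rightarrow> ((int \<Rightarrow> real) \<Rightarrow> 'b) \<Rightarrow> bool" where
  "torus_map J f \<longleftrightarrow> (\<forall>x y. (\<forall>j\<in>J. x j - y j \<in> \<int>) \<longrightarrow> f x = f y)"

definition rotation_measure :: "int set \<Rightarrow> (int \<Rightarrow> real) measure" where
  "rotation_measure J =
     PiM J (\<lambda>_. uniform_measure lborel (if finite J then {0..1} else {1..2}))"

text \<open>
  For infinite \<open>J\<close> the integral over the variables in a finite set \<open>A\<close> still depends on the
  remaining variables \<open>y\<close>; the limit along increasing \<open>A\<close> is required to be the same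
  constant for every \<open>y\<close>.
\<close>

definition torus_integral :: "int set \<Rightarrow> ((int \<Rightarrow> real) \<Rightarrow> complex) \<Rightarrow> complex" where
  "torus_integral J f =
     (if finite J
      then LINT x|PiM J (\<lambda>_. uniform_measure lborel {0..1}). f x
      else THE I. \<forall>y.
        ((\<lambda>A. LINT x|PiM A (\<lambda>_. uniform_measure lborel {0..1}).
                f (\<lambda>j. if j \<in> A then x j else y j)) \<longlongrightarrow> I) (finite_subsets_at_top J))"

definition bracket :: "int \<Rightarrow> int" where
  "bracket j = max 1 \<bar>j\<bar>"

definition l1_norm :: "int set \<Rightarrow> (int \<Rightarrow> int) \<Rightarrow> real" where
  "l1_norm J k = (\<Sum>j\<in>J. real_of_int \<bar>k j\<bar>)"

definition eta_norm :: "nat \<Rightarrow> int set \<Rightarrow> (int \<Rightarrow> int) \<Rightarrow> real" where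
  "eta_norm \<eta> J k = (\<Sum>\<^sub>\<infinity>j\<in>J. real_of_int (bracket j ^ \<eta> * \<bar>k j\<bar>))"

text \<open>
  Integer vectors indexed by \<open>J\<close> vanish off \<open>J\<close>. Summability says that
  \<^term>\<open>eta_norm \<eta> J k\<close> is finite.
\<close>

definition freqs :: "nat \<Rightarrow> int set \<Rightarrow> (int \<Rightarrow> int) set" where
  "freqs \<eta> J = {k. (\<forall>j. j \<notin> J \<longrightarrow> k j = 0) \<and>
     (infinite J \<longrightarrow> (\<lambda>j. real_of_int (bracket j ^ \<eta> * \<bar>k j\<bar>)) summable_on J)}"

definition freq_norm :: "nat \<Rightarrow> int set \<Rightarrow> (int \<Rightarrow> int) \<Rightarrow> real" where
  "freq_norm \<eta> J k = (if finite J then l1_norm J k else eta_norm \<eta> J k)"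

definition pairing :: "int set \<Rightarrow> (int \<Rightarrow> int) \<Rightarrow> (int \<Rightarrow> 'a::real_normed_field) \<Rightarrow> 'a" where
  "pairing J k x = (\<Sum>\<^sub>\<infinity>j\<in>J. of_int (k j) * x j)"

definition fourier ::
    "int set \<Rightarrow> ((int \<Rightarrow> real) \<Rightarrow> 'i \<Rightarrow> real) \<Rightarrow> (int \<Rightarrow> int) \<Rightarrow> 'i \<Rightarrow> complex" where
  "fourier J K s i = torus_integral J
     (\<lambda>x. of_real (K x i) * exp (- 2 * pi * \<i> * of_real (pairing J s x)))"

definition complex_strip :: "nat \<Rightarrow> int set \<Rightarrow> real \<Rightarrow> (int \<Rightarrow> complex) set" where
  "complex_strip \<eta> J \<sigma> =
     {z. \<forall>j\<in>J. \<bar>Im (z j)\<bar> \<le> \<sigma> * (if finite J then 1 else real_of_int (bracket j ^ \<eta>))}"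

definition torus_analytic ::
    "nat \<Rightarrow> int set \<Rightarrow> ((int \<Rightarrow> real) \<Rightarrow> 'i \<Rightarrow> real) \<Rightarrow> bool" where
  "torus_analytic \<eta> J K \<longleftrightarrow> torus_map J K \<and>
     (\<exists>\<sigma>>0. \<exists>G :: (int \<Rightarrow> complex) \<Rightarrow> 'i \<Rightarrow> complex.
        (\<forall>x i. G (\<lambda>j. of_real (x j)) i = of_real (K x i)) \<and>
        (\<forall>z\<in>complex_strip \<eta> J \<sigma>. \<forall>i.
           ((\<lambda>k. fourier J K k i * exp (2 * pi * \<i> * pairing J k z)) has_sum G z i)
             (freqs \<eta> J)) \<and>
        (\<Sum>\<^sub>\<infinity>k\<in>freqs \<eta> J.
           linf (fourier J K k) * ennreal (exp (2 * pi * \<sigma> * freq_norm \<eta> J k))) < \<infinity>)"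

definition fourier_error ::
    "real \<Rightarrow> real \<Rightarrow> int set \<Rightarrow> ((int \<Rightarrow> real) \<Rightarrow> 'i \<Rightarrow> real) \<Rightarrow> (('i \<Rightarrow> real) \<Rightarrow> 'i \<Rightarrow> real) \<Rightarrow>
     (int \<Rightarrow> real) \<Rightarrow> nat \<Rightarrow> (int \<Rightarrow> int) \<Rightarrow> (int \<Rightarrow> real) \<Rightarrow> ennreal" where
  "fourier_error p q J K F \<rho> N s \<theta> = linf (\<lambda>i.
     fourier J K s i -
     exp (- 2 * pi * \<i> * of_real (pairing J s \<theta>)) * of_real (1 / weight_total p q N) *
       (\<Sum>n = 1..N - 1. of_real (weight p q (real n / real N)) * of_real ((F ^^ n) (K \<theta>) i) *
          exp (- 2 * pi * \<i> * of_real (real n * pairing J s \<rho>))))"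

end

theory Submission
  imports Defs "HOL-Complex_Analysis.Cauchy_Integral_Formula" "HOL-Real_Asymp.Real_Asymp"
begin

text \<open>
  Since \<open>p\<^sub>n = K (\<theta> + n \<rho>)\<close>, inserting the Fourier expansion of \<open>K\<close> into the weighted sum
  reproduces the coefficient of frequency \<open>s\<close> exactly, and each other frequency \<open>k\<close> contributes, up to
  sign, its coefficient times \<open>exp (2 \<pi> i \<langle>k - s, \<theta>\<rangle>) W\<^sub>N(\<langle>k - s, \<rho>\<rangle>)\<close> to the error, where \<open>W\<^sub>N(\<alpha>)\<close> is the
  weighted average of the character \<open>n \<mapsto> exp (2 \<pi> i n \<alpha>)\<close> (\<open>fourier_error_le\<close>). Two facts make
  these contributions small.

  The weight is smooth and flat at the endpoints. It extends holomorphically to discs whose radius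
  is proportional to the distance to the endpoints, without losing its exponential decay there, so
  Cauchy's inequality shows that it is of Gevrey order \<open>1 + 1 / min p q\<close> (\<open>bump_deriv_gevrey\<close>).
  Summation by parts, repeated an optimal number of times, then gives
  \<open>\<bar>W\<^sub>N(\<alpha>)\<bar> \<le> C N exp (- c (N \<delta>)^\<beta>)\<close> where \<open>\<delta> = \<bar>1 - exp (2 \<pi> i \<alpha>)\<bar>\<close> and
  \<open>\<beta> = 1 / (1 + 1 / min p q)\<close> (\<open>weighted_avg_decay\<close>).

  Almost every rotation is nonresonant: \<open>\<delta>\<close> at \<open>\<alpha> = \<langle>k, \<rho>\<rangle>\<close> is at least
  \<open>\<gamma> \<Prod>j. (\<langle>j\<rangle> \<bar>k j\<bar>)^{-\<mu>}\<close>, the product being over the support of \<open>k\<close>, for each of countably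
  many \<open>\<mu> > 1\<close> tending to 1, with some \<open>\<gamma> > 0\<close> that may depend on \<open>\<mu>\<close> and on the
  rotation. The set of rotations that violate this for given \<open>k\<close> and \<open>\<gamma>\<close> has
  measure at most a multiple of the right side, and these products are summable over \<open>k\<close> in every
  dimension (\<open>AE_nonresonant\<close>).

  To reach the rate \<open>exp (- \<phi> N)\<close>, frequencies of norm above a multiple of \<open>\<phi> N\<close> are left to the
  decay of the Fourier coefficients, and the others to the decay of the averages
  (\<open>error_rate\<close>). In dimension \<open>d\<close>, with \<open>\<phi> N = N^\<zeta>\<close>, the divisors are at least of order
  \<open>N^{- \<zeta> d \<mu>}\<close>, and the averages beat \<open>exp (- N^\<zeta>)\<close> as soon as
  \<open>\<zeta> (d \<mu> + 1 + 1 / min p q) < 1\<close> (\<open>finite_dim_decay\<close>). In infinite dimension, a frequency of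
  norm \<open>\<Lambda>\<close> has only \<open>O(\<Lambda>^{1/(1+\<eta>)})\<close> nonzero coordinates, each of size at most \<open>\<Lambda>\<close>. For
  \<open>\<Lambda> = O((ln N)^\<zeta>)\<close> with \<open>\<zeta> < 1 + \<eta>\<close> the divisors therefore decay more slowly than any power of
  \<open>N\<close>, and the averages are smaller than \<open>exp (- (ln N)^\<zeta>)\<close> (\<open>infinite_dim_decay\<close>).
\<close>

section \<open>The complex bump function\<close>

text \<open>
  The holomorphic extension of the bump. On the strip \<open>0 < Re z < 1\<close> neither \<open>z\<close> nor
  \<open>1 - z\<close> meets the cut of the principal branch of \<open>powr\<close>.
\<close>

definition complex_bump :: "real \<Rightarrow> real \<Rightarrow> complex \<Rightarrow> complex" where
  "complex_bump p q z = exp (- (z powr (- of_real p) * (1 - z) powr (- of_real q)))"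

lemma complex_bump_of_real:
  assumes "0 < x" "x < 1"
  shows "complex_bump p q (of_real x) = of_real (bump p q x)"
proof -
  have "(1 - complex_of_real x) = of_real (1 - x)" by simp
  then have "(1 - complex_of_real x) powr (- of_real q) = of_real ((1 - x) powr (- q))"
    using assms by (metis powr_of_real diff_ge_0_iff_ge less_imp_le of_real_minus)
  moreover have "(complex_of_real x) powr (- of_real p) = of_real (x powr (- p))"
    using assms by (metis powr_of_real less_imp_le of_real_minus)
  ultimately show ?thesis
    by (simp add: complex_bump_def bump_def flip: exp_of_real)
qed

lemma complex_bump_holomorphic: "complex_bump p q holomorphic_on {z. 0 < Re z \<and> Re z < 1}"
  unfolding complex_bump_def
  by (intro holomorphic_intros) (auto simp: complex_nonpos_Reals_iff)

lemma powr_near_one: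
  fixes a :: complex
  shows "\<exists>c>0. \<forall>u. cmod u \<le> c \<longrightarrow> cmod ((1 + u) powr a - 1) \<le> 1/5"
proof -
  have "((\<lambda>u::complex. (1 + u) powr a) \<longlongrightarrow> (1 + 0) powr a) (at 0)"
    by (intro tendsto_intros) (auto simp: complex_nonpos_Reals_iff)
  then have "\<forall>\<^sub>F u in at (0::complex). dist ((1 + u) powr a) 1 < 1/5"
    by (metis add.right_neutral powr_one_eq_one tendstoD zero_less_divide_iff zero_less_numeral zero_less_one)
  then obtain d where d: "d > 0" "\<And>u. u \<noteq> 0 \<Longrightarrow> dist u 0 < d \<Longrightarrow> dist ((1 + u) powr a) 1 < 1/5"
    unfolding eventually_at by blast
  have "cmod ((1 + u) powr a - 1) \<le> 1/5" if "cmod u \<le> d/2" for u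
    using d(2)[of u] that d(1) by (cases "u = 0") (auto simp: dist_norm)
  then show ?thesis using d(1) by (intro exI[of _ "d/2"]) auto
qed

lemma powr_real_scale:
  fixes w :: complex
  assumes "0 < x" "w \<noteq> 0"
  shows "(of_real x * w) powr (- of_real p) = of_real (x powr (- p)) * w powr (- of_real p)"
  using assms powr_times_real_left[of "of_real x" w "- of_real p"] powr_of_real[of x "-p"] by simp

text \<open>
  On a disc around \<open>x\<close> whose radius is a small fraction of the distance \<open>t\<close> to the
  endpoints, \<open>z\<close> and \<open>1 - z\<close> change only by relative amounts \<open>u\<close>, \<open>v\<close> with
  \<open>\<bar>u\<bar>, \<bar>v\<bar> \<le> c\<close>. The factor \<open>(1+u)^{-p} (1+v)^{-q}\<close> is then close to 1, so the real part
  of the exponent stays at least half of its size on the real axis, and that is at least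
  \<open>t^{-r}\<close> with \<open>r = min p q\<close>.
\<close>

lemma sector_bound:
  fixes p q :: real
  assumes "0 < p" "0 < q"
  obtains c where "0 < c" "c \<le> 1/2"
    "\<And>x z. 0 < x \<Longrightarrow> x < 1 \<Longrightarrow> cmod (z - of_real x) \<le> c * min x (1 - x) \<Longrightarrow>
       cmod (complex_bump p q z) \<le> exp (- (min x (1 - x) powr (- min p q)) / 2)"
proof -
  obtain c1 where c1: "c1 > 0" "\<And>u. cmod u \<le> c1 \<Longrightarrow> cmod ((1 + u) powr (- of_real p) - 1) \<le> 1/5"
    using powr_near_one[of "- of_real p"] by blast
  obtain c2 where c2: "c2 > 0" "\<And>u. cmod u \<le> c2 \<Longrightarrow> cmod ((1 + u) powr (- of_real q) - 1) \<le> 1/5"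
    using powr_near_one[of "- of_real q"] by blast
  define c where "c = min (1/2) (min c1 c2)"
  have c: "c > 0" "c \<le> 1/2" "c \<le> c1" "c \<le> c2" using c1(1) c2(1) by (auto simp: c_def)
  have "cmod (complex_bump p q z) \<le> exp (- (min x (1 - x) powr (- min p q)) / 2)"
    if x: "0 < x" "x < 1" and z: "cmod (z - of_real x) \<le> c * min x (1 - x)" for x z
  proof -
    define u where "u = (z - of_real x) / of_real x"
    define v where "v = (of_real x - z) / of_real (1 - x)"
    have zu: "z = of_real x * (1 + u)" using x by (simp add: u_def field_simps)
    have "complex_of_real (1 - x) \<noteq> 0" using x by (metis diff_gt_0_iff_gt less_irrefl of_real_eq_0_iff)
    then have zv: "1 - z = of_real (1 - x) * (1 + v)" by (simp add: v_def distrib_left)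
    have "cmod u \<le> c"
    proof -
      have "cmod (z - of_real x) \<le> c * x" using z mult_left_mono[of "min x (1-x)" x c] c by linarith
      then show ?thesis unfolding u_def norm_divide using x by (simp add: field_simps)
    qed
    moreover have "cmod v \<le> c"
    proof -
      have "cmod (of_real x - z) \<le> c * (1-x)"
        using z mult_left_mono[of "min x (1-x)" "1-x" c] c norm_minus_commute[of z "of_real x"] by linarith
      then show ?thesis unfolding v_def norm_divide norm_of_real using x by (simp add: field_simps)
    qed
    ultimately have uv: "cmod u \<le> c" "cmod v \<le> c" by auto
    have n0: "1 + w \<noteq> 0" if "cmod w \<le> c" for w
    proof
      assume "1 + w = 0"
      then have "w = - 1" by (simp add: add_eq_0_iff)
      then show False using that c by simp
    qed
    define A where "A = (1 + u) powr (- of_real p) - 1"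
    define B where "B = (1 + v) powr (- of_real q) - 1"
    have AB: "cmod A \<le> 1/5" "cmod B \<le> 1/5" using c1(2) c2(2) uv c by (auto simp: A_def B_def)
    have "cmod ((1 + A) * (1 + B) - 1) \<le> cmod A + cmod B + cmod A * cmod B"
      using norm_triangle_le[of "A + B" "A * B", OF add_mono[OF norm_triangle_ineq order_refl]]
      by (simp add: algebra_simps norm_mult)
    \<comment> \<open>two errors of 1/5 still leave a real part of at least 1/2\<close>
    also have "\<dots> \<le> 1/5 + 1/5 + 1/5 * (1/5)"
      using AB by (intro add_mono mult_mono) auto
    finally have "cmod ((1 + A) * (1 + B) - 1) \<le> 1/2" by simp
    then have re: "Re ((1 + A) * (1 + B)) \<ge> 1/2"
      using abs_Re_le_cmod[of "(1 + A) * (1 + B) - 1"] by simp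
    define t where "t = min x (1 - x)"
    define r where "r = min p q"
    have t: "0 < t" "t \<le> x" "t \<le> 1 - x" "t < 1" using x by (auto simp: t_def)
    have "t powr (-r) \<le> x powr (-p) * (1-x) powr (-q)"
    proof (cases "x \<le> 1 - x")
      case True
      then have "t = x" by (simp add: t_def)
      then have "t powr (-r) \<le> x powr (-p)" using t by (auto simp: r_def intro!: powr_mono')
      also have "\<dots> \<le> x powr (-p) * (1-x) powr (-q)"
        using x assms ge_one_powr_ge_zero[of "1/(1-x)" q]
        by (simp add: powr_minus powr_divide field_simps)
      finally show ?thesis .
    next
      case False
      then have "t = 1 - x" by (simp add: t_def)
      then have "t powr (-r) \<le> (1-x) powr (-q)" using t by (auto simp: r_def intro!: powr_mono')
      also have "\<dots> \<le> x powr (-p) * (1-x) powr (-q)"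
        using x assms ge_one_powr_ge_zero[of "1/x" p]
        by (simp add: powr_minus powr_divide field_simps)
      finally show ?thesis .
    qed
    moreover have "Re (z powr (- of_real p) * (1 - z) powr (- of_real q)) =
        (x powr (-p) * (1-x) powr (-q)) * Re ((1 + A) * (1 + B))"
    proof -
      have "z powr (- of_real p) * (1 - z) powr (- of_real q) =
        of_real (x powr (-p) * (1-x) powr (-q)) * ((1 + A) * (1 + B))"
        unfolding zv unfolding zu using powr_real_scale[OF x(1) n0[OF uv(1)], of p] powr_real_scale[OF _ n0[OF uv(2)], of "1-x" q] x
        by (simp add: A_def B_def)
      then show ?thesis by simp
    qed
    moreover have "(x powr (-p) * (1-x) powr (-q)) * Re ((1 + A) * (1 + B)) \<ge> (x powr (-p) * (1-x) powr (-q)) * (1/2)"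
      using re by (intro mult_left_mono) auto
    ultimately have "Re (z powr (- of_real p) * (1 - z) powr (- of_real q)) \<ge> t powr (-r) / 2" by linarith
    then show ?thesis by (simp add: complex_bump_def t_def r_def)
  qed
  then show ?thesis using that c by blast
qed

text \<open>
  Cauchy's inequality on the discs of \<open>sector_bound\<close>. The factorial and the power of the
  radius are the only loss; the exponential keeps its full strength near the endpoints.
\<close>

lemma complex_bump_deriv_bound:
  fixes p q :: real
  assumes "0 < p" "0 < q"
  obtains c where "0 < c"
    "\<And>x m. 0 < x \<Longrightarrow> x < 1 \<Longrightarrow> cmod ((deriv ^^ m) (complex_bump p q) (of_real x))
       \<le> fact m * exp (- (min x (1 - x) powr (- min p q)) / 2) / (c * min x (1 - x)) ^ m"
proof -
  obtain c where c: "0 < c" "c \<le> 1/2"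
    "\<And>x z. 0 < x \<Longrightarrow> x < 1 \<Longrightarrow> cmod (z - of_real x) \<le> c * min x (1 - x) \<Longrightarrow>
       cmod (complex_bump p q z) \<le> exp (- (min x (1 - x) powr (- min p q)) / 2)"
    using sector_bound[OF assms] by blast
  have "cmod ((deriv ^^ m) (complex_bump p q) (of_real x))
       \<le> fact m * exp (- (min x (1 - x) powr (- min p q)) / 2) / (c * min x (1 - x)) ^ m"
    if x: "0 < x" "x < 1" for x m
  proof (rule Cauchy_inequality)
    have t: "0 < min x (1-x)" using x by auto
    then show "0 < c * min x (1 - x)" using c by simp
    have sub: "cball (of_real x) (c * min x (1 - x)) \<subseteq> {z. 0 < Re z \<and> Re z < 1}"
    proof
      fix z assume "z \<in> cball (complex_of_real x) (c * min x (1 - x))"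
      then have "cmod (z - of_real x) \<le> c * min x (1 - x)" by (simp add: dist_norm norm_minus_commute)
      also have "\<dots> \<le> 1/2 * min x (1 - x)" using c t by (intro mult_right_mono) auto
      finally have "\<bar>Re z - x\<bar> \<le> 1/2 * min x (1-x)"
        using abs_Re_le_cmod[of "z - of_real x"] by simp
      then show "z \<in> {z. 0 < Re z \<and> Re z < 1}" using x by (auto simp: min_def abs_if split: if_splits)
    qed
    then show "complex_bump p q holomorphic_on ball (of_real x) (c * min x (1 - x))"
      by (rule holomorphic_on_subset[OF complex_bump_holomorphic order_trans[OF ball_subset_cball]])
    show "continuous_on (cball (of_real x) (c * min x (1 - x))) (complex_bump p q)"
      by (rule holomorphic_on_imp_continuous_on[OF holomorphic_on_subset[OF complex_bump_holomorphic sub]])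
    fix z assume "cmod (complex_of_real x - z) = c * min x (1 - x)"
    then show "cmod (complex_bump p q z) \<le> exp (- (min x (1 - x) powr (- min p q)) / 2)"
      using c(3)[OF x, of z] by (simp add: norm_minus_commute)
  qed
  then show ?thesis using that c(1) by blast
qed

section \<open>Exponential sums of the bump\<close>

text \<open>
  All derivatives of the bump, extended by zero to the real line, and complex valued so that
  they can be read off from the holomorphic extension.
\<close>

definition bump_deriv :: "real \<Rightarrow> real \<Rightarrow> nat \<Rightarrow> real \<Rightarrow> complex" where
  "bump_deriv p q m x = (if 0 < x \<and> x < 1 then (deriv ^^ m) (complex_bump p q) (of_real x) else 0)"

text \<open>
  The exponential beats every power, with the explicit constant that comes from
  \<open>ln w \<le> w\<close> at \<open>w = k y / a\<close>. The growth of the constant in \<open>a\<close> is what decides the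
  Gevrey order of the bump.
\<close>

lemma powr_exp_le:
  fixes a k y :: real
  assumes "0 < a" "0 < k" "0 < y"
  shows "y powr a * exp (- (k * y)) \<le> (a / k) powr a"
proof -
  have "(k * y / a) powr a \<le> exp (k * y)"
  proof -
    have "ln (k * y / a) \<le> k * y / a" using assms by (intro less_imp_le ln_less_self) auto
    then have "a * ln (k * y / a) \<le> k * y" using assms by (simp add: field_simps)
    then show ?thesis using assms by (simp add: powr_def)
  qed
  moreover have "y powr a = (a / k) powr a * (k * y / a) powr a"
    using assms by (subst powr_mult [symmetric]) auto
  ultimately have "y powr a \<le> (a / k) powr a * exp (k * y)"
    by (simp add: mult_left_mono)
  then show ?thesis by (simp add: exp_minus field_simps)
qed

lemma exp_div_power_le:
  fixes t r :: real
  assumes "0 < t" "0 < r" "1 \<le> n"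
  shows "exp (- (t powr (- r)) / 2) / t ^ n \<le> (2 * real n / r) powr (real n / r)"
proof -
  have "(t powr (- r)) powr (real n / r) * exp (- (1/2 * t powr (- r))) \<le> (real n / r / (1/2)) powr (real n / r)"
    using assms by (intro powr_exp_le) auto
  moreover have "(t powr (- r)) powr (real n / r) = 1 / t ^ n"
  proof -
    have "(t powr (- r)) powr (real n / r) = t powr (- real n)" using assms by (simp add: powr_powr)
    then show ?thesis using assms by (simp add: powr_minus powr_realpow field_simps)
  qed
  ultimately show ?thesis by (simp add: field_simps)
qed

text \<open>
  The estimate that makes the pieces fit together at the endpoints: any derivative is
  quadratically small near each point outside \<open>(0,1)\<close>, hence differentiable there with
  derivative zero. Two powers of \<open>t\<close> are spared by estimating \<open>t^{-(m+2)} exp (-t^{-r}/2)\<close>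
  in place of \<open>t^{-m} exp (-t^{-r}/2)\<close>.
\<close>

lemma bump_deriv_quadratic:
  assumes "0 < p" "0 < q"
  obtains C where "0 \<le> C" "\<And>x. \<not> (0 < x \<and> x < 1) \<Longrightarrow> \<forall>y. cmod (bump_deriv p q m y) \<le> C * (y - x)\<^sup>2"
proof -
  obtain c where c: "0 < c"
    "\<And>x m. 0 < x \<Longrightarrow> x < 1 \<Longrightarrow> cmod ((deriv ^^ m) (complex_bump p q) (of_real x))
       \<le> fact m * exp (- (min x (1 - x) powr (- min p q)) / 2) / (c * min x (1 - x)) ^ m"
    using complex_bump_deriv_bound[OF assms] by blast
  define r where "r = min p q"
  have r: "0 < r" using assms by (simp add: r_def)
  define B where "B = (2 * real (m + 2) / r) powr (real (m + 2) / r)"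
  define C where "C = fact m / c ^ m * B"
  have C0: "0 \<le> C" using c by (simp add: C_def B_def)
  have "cmod (bump_deriv p q m y) \<le> C * (y - x)\<^sup>2" if x: "\<not> (0 < x \<and> x < 1)" for x y
  proof (cases "0 < y \<and> y < 1")
    case True
    define t where "t = min y (1 - y)"
    have t: "0 < t" using True by (simp add: t_def)
    have "cmod (bump_deriv p q m y) \<le> fact m * exp (- (t powr (- r)) / 2) / (c * t) ^ m"
      using c(2)[of y m] True by (simp add: bump_deriv_def t_def r_def)
    also have "\<dots> = fact m / c ^ m * (exp (- (t powr (- r)) / 2) / t ^ (m + 2)) * t\<^sup>2"
      using c t by (simp add: power_mult_distrib power_add field_simps power2_eq_square)
    also have "\<dots> \<le> fact m / c ^ m * B * t\<^sup>2"
      unfolding B_def using c t r by (intro mult_right_mono mult_left_mono exp_div_power_le) auto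
    also have "\<dots> \<le> C * (y - x)\<^sup>2"
    proof -
      have "\<bar>t\<bar> \<le> \<bar>y - x\<bar>" using x True by (auto simp: t_def min_def)
      then have "t\<^sup>2 \<le> (y - x)\<^sup>2" by (simp add: abs_le_square_iff)
      then show ?thesis using C0 unfolding C_def by (intro mult_left_mono) auto
    qed
    finally show ?thesis .
  qed (use C0 in \<open>auto simp: bump_deriv_def\<close>)
  then show ?thesis using that C0 by blast
qed

lemma bump_deriv_has_vector_derivative:
  assumes "0 < p" "0 < q"
  shows "(bump_deriv p q m has_vector_derivative bump_deriv p q (Suc m) x) (at x)"
proof (cases "0 < x \<and> x < 1")
  case True
  let ?S = "{z::complex. 0 < Re z \<and> Re z < 1}"
  have S: "open ?S"
  proof -
    have "?S = {z. 0 < Re z} \<inter> {z. Re z < 1}" by auto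
    then show ?thesis by (simp add: open_Int open_halfspace_Re_gt open_halfspace_Re_lt)
  qed
  have "((deriv ^^ m) (complex_bump p q) has_field_derivative deriv ((deriv ^^ m) (complex_bump p q)) (of_real x)) (at (of_real x))"
    using True S by (intro holomorphic_derivI[OF holomorphic_higher_deriv[OF complex_bump_holomorphic S] S]) auto
  then have "((\<lambda>y. (deriv ^^ m) (complex_bump p q) (of_real y)) has_vector_derivative (deriv ^^ Suc m) (complex_bump p q) (of_real x)) (at x)"
    using has_vector_derivative_real_field by fastforce
  then have "(bump_deriv p q m has_vector_derivative (deriv ^^ Suc m) (complex_bump p q) (of_real x)) (at x)"
    by (rule has_vector_derivative_transform_within_open[of _ _ _ "{0<..<1}"]) (use True in \<open>auto simp: bump_deriv_def\<close>)
  then show ?thesis using True by (simp add: bump_deriv_def)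
next
  case False
  obtain C where C: "0 \<le> C" "\<forall>y. cmod (bump_deriv p q m y) \<le> C * (y - x)\<^sup>2"
    using bump_deriv_quadratic[OF assms, of m] False by metis
  have z: "bump_deriv p q n x = 0" for n using False unfolding bump_deriv_def by (rule if_not_P)
  have "((\<lambda>y. norm (bump_deriv p q m y - bump_deriv p q m x - (y - x) *\<^sub>R 0) / norm (y - x)) \<longlongrightarrow> 0) (at x)"
  proof (rule Lim_null_comparison)
    show "\<forall>\<^sub>F y in at x. norm (norm (bump_deriv p q m y - bump_deriv p q m x - (y - x) *\<^sub>R 0) / norm (y - x)) \<le> C * \<bar>y - x\<bar>"
      using C z by (auto simp: eventually_at_filter power2_eq_square field_simps
          intro!: always_eventually)
    have "((\<lambda>y. C * \<bar>y - x\<bar>) \<longlongrightarrow> C * \<bar>x - x\<bar>) (at x)" by (intro tendsto_intros)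
    then show "((\<lambda>y. C * \<bar>y - x\<bar>) \<longlongrightarrow> 0) (at x)" by simp
  qed
  then show ?thesis
    by (simp add: has_vector_derivative_def has_derivative_iff_norm z bounded_linear_zero)
qed

text \<open>
  The bump is of Gevrey order \<open>1 + 1/r\<close>: the factorial from Cauchy's inequality contributes
  \<open>m^m\<close>, and the maximum over \<open>t\<close> of \<open>t^{-m} exp (-t^{-r}/2)\<close> contributes
  \<open>m^{m/r}\<close> up to an exponential factor.
\<close>

lemma bump_deriv_gevrey:
  assumes "0 < p" "0 < q"
  obtains b where "1 \<le> b"
    "\<And>m x. 1 \<le> m \<Longrightarrow> cmod (bump_deriv p q m x) \<le> (b * real m powr (1 + 1 / min p q)) ^ m"
proof -
  obtain c where c: "0 < c"
    "\<And>x m. 0 < x \<Longrightarrow> x < 1 \<Longrightarrow> cmod ((deriv ^^ m) (complex_bump p q) (of_real x))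
       \<le> fact m * exp (- (min x (1 - x) powr (- min p q)) / 2) / (c * min x (1 - x)) ^ m"
    using complex_bump_deriv_bound[OF assms] by blast
  define r where "r = min p q"
  have r: "0 < r" using assms by (simp add: r_def)
  define b where "b = max 1 ((2 / r) powr (1 / r) / c)"
  have "cmod (bump_deriv p q m x) \<le> (b * real m powr (1 + 1 / r)) ^ m" if m: "1 \<le> m" for m x
  proof (cases "0 < x \<and> x < 1")
    case True
    define t where "t = min x (1 - x)"
    have t: "0 < t" using True by (simp add: t_def)
    have "cmod (bump_deriv p q m x) \<le> fact m * exp (- (t powr (- r)) / 2) / (c * t) ^ m"
      using c(2)[of x m] True by (simp add: bump_deriv_def t_def r_def)
    also have "\<dots> = fact m / c ^ m * (exp (- (t powr (- r)) / 2) / t ^ m)"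
      by (simp add: power_mult_distrib)
    also have "\<dots> \<le> fact m / c ^ m * ((2 * real m / r) powr (real m / r))"
      using c t r m by (intro mult_left_mono exp_div_power_le) auto
    also have "\<dots> \<le> real m ^ m / c ^ m * ((2 * real m / r) powr (real m / r))"
      using fact_le_power[of m, where 'a=real] c by (intro mult_right_mono divide_right_mono) auto
    also have "(2 * real m / r) powr (real m / r) = ((2 / r) powr (1 / r) * real m powr (1 / r)) ^ m"
      using r m by (simp add: powr_mult [symmetric] powr_powr powr_realpow [symmetric])
    also have "real m ^ m / c ^ m * \<dots> = (((2 / r) powr (1 / r) / c) * real m powr (1 + 1 / r)) ^ m"
      using m by (simp add: powr_add power_mult_distrib power_divide)
    also have "\<dots> \<le> (b * real m powr (1 + 1 / r)) ^ m"
      using c by (intro power_mono mult_right_mono) (auto simp: b_def)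
    finally show ?thesis .
  qed (auto simp: bump_deriv_def b_def)
  moreover have "1 \<le> b" by (simp add: b_def)
  ultimately show ?thesis using that unfolding r_def by blast
qed

primrec backward_diff :: "real \<Rightarrow> nat \<Rightarrow> (real \<Rightarrow> complex) \<Rightarrow> real \<Rightarrow> complex" where
  "backward_diff h 0 f = f"
| "backward_diff h (Suc m) f = (\<lambda>x. backward_diff h m f x - backward_diff h m f (x - h))"

lemma backward_diff_has_vector_derivative:
  assumes "\<And>x. (f has_vector_derivative f' x) (at x)"
  shows "(backward_diff h m f has_vector_derivative backward_diff h m f' x) (at x)"
proof (induction m arbitrary: x)
  case (Suc m)
  have "((\<lambda>y. y - h) has_vector_derivative 1) (at x)"
    by (auto intro!: derivative_eq_intros)
  then have "((backward_diff h m f \<circ> (\<lambda>y. y - h)) has_vector_derivative 1 *\<^sub>R backward_diff h m f' (x - h)) (at x)"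
    by (rule vector_diff_chain_at) (use Suc.IH in auto)
  then show ?case
    using has_vector_derivative_diff[OF Suc.IH[of x]] by (simp add: o_def)
qed (use assms in auto)

text \<open>
  The mean value inequality, \<open>m\<close> times. The whole sequence of derivatives takes part in the
  induction because differencing commutes with differentiation.
\<close>

lemma norm_backward_diff_le:
  fixes g :: "nat \<Rightarrow> real \<Rightarrow> complex"
  assumes "\<And>i x. (g i has_vector_derivative g (Suc i) x) (at x)" "0 \<le> h"
    and "\<And>x. cmod (g (i + m) x) \<le> B"
  shows "cmod (backward_diff h m (g i) x) \<le> h ^ m * B"
  using assms(3)
proof (induction m arbitrary: i x)
  case (Suc m)
  have IH: "cmod (backward_diff h m (g (Suc i)) x) \<le> h ^ m * B" for x
    using Suc.IH[of "Suc i" x] Suc.prems by simp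
  have "norm (backward_diff h m (g i) x - backward_diff h m (g i) (x - h)) \<le> (h ^ m * B) * norm (x - (x - h))"
  proof (rule differentiable_bound[of UNIV _ "\<lambda>x t. t *\<^sub>R backward_diff h m (g (Suc i)) x"])
    show "(backward_diff h m (g i) has_derivative (\<lambda>t. t *\<^sub>R backward_diff h m (g (Suc i)) x)) (at x within UNIV)" for x
      using backward_diff_has_vector_derivative[OF assms(1)] by (simp add: has_vector_derivative_def)
    show "onorm (\<lambda>t. t *\<^sub>R backward_diff h m (g (Suc i)) x) \<le> h ^ m * B" for x
      using IH[of x] by (intro onorm_le) (simp add: mult.commute mult_left_mono)
  qed auto
  then show ?case using assms(2) by (simp add: mult_ac)
qed auto

lemma backward_diff_eq_0:
  assumes "\<And>x. x \<le> 0 \<or> 1 \<le> x \<Longrightarrow> f x = 0" "0 \<le> h" "x \<le> 0 \<or> 1 + real m * h \<le> x"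
  shows "backward_diff h m f x = 0"
  using assms(3)
proof (induction m arbitrary: x)
  case (Suc m)
  have "backward_diff h m f x = 0" using Suc.IH[of x] Suc.prems assms(2) by (auto simp: algebra_simps)
  moreover have "backward_diff h m f (x - h) = 0" using Suc.IH[of "x-h"] Suc.prems assms(2) by (auto simp: algebra_simps)
  ultimately show ?case by simp
qed (use assms in auto)

text \<open>
  For a function supported in \<open>(0,1)\<close> there are no boundary terms, so each difference
  multiplies the exponential sum by \<open>1 - z\<close>. The support of the \<open>m\<close>-th difference reaches
  \<open>m\<close> steps beyond 1, whence the longer range on the left.
\<close>

lemma exponential_sum_summation_by_parts:
  assumes f: "\<And>x. x \<le> 0 \<or> 1 \<le> x \<Longrightarrow> f x = 0" and N: "0 < N"
  shows "(\<Sum>n<N + m. backward_diff (1 / real N) m f (real n / real N) * z ^ n)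
    = (1 - z) ^ m * (\<Sum>n<N. f (real n / real N) * z ^ n)"
proof (induction m)
  case (Suc m)
  define F where "F n = backward_diff (1 / real N) m f (real n / real N)" for n
  have e: "F (N + m) = 0" unfolding F_def
    using N by (intro backward_diff_eq_0 f) (auto simp: field_simps)
  have b: "backward_diff (1 / real N) m f (- 1 / real N) = 0"
    using N by (intro backward_diff_eq_0 f) (auto simp: field_simps)
  have "(\<Sum>n<N + Suc m. backward_diff (1 / real N) (Suc m) f (real n / real N) * z ^ n)
     = (\<Sum>n<Suc (N + m). F n * z ^ n) - (\<Sum>n<Suc (N + m). backward_diff (1 / real N) m f (real n / real N - 1 / real N) * z ^ n)"
    by (simp add: F_def sum_subtractf algebra_simps)
  also have "(\<Sum>n<Suc (N + m). F n * z ^ n) = (\<Sum>n<N + m. F n * z ^ n)"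
    using e by simp
  also have "(\<Sum>n<Suc (N + m). backward_diff (1 / real N) m f (real n / real N - 1 / real N) * z ^ n)
     = z * (\<Sum>n<N + m. F n * z ^ n)"
    using b by (subst sum.lessThan_Suc_shift) (simp add: F_def diff_divide_distrib [symmetric] sum_distrib_left mult_ac)
  also have "(\<Sum>n<N + m. F n * z ^ n) - z * (\<Sum>n<N + m. F n * z ^ n) = (1 - z) * (\<Sum>n<N + m. F n * z ^ n)"
    by (simp add: algebra_simps)
  also have "\<dots> = (1 - z) ^ Suc m * (\<Sum>n<N. f (real n / real N) * z ^ n)"
    using Suc.IH by (simp add: F_def)
  finally show ?case .
qed simp

lemma bump_deriv_0: "bump_deriv p q 0 x = (if 0 < x \<and> x < 1 then of_real (bump p q x) else 0)"
  by (simp add: bump_deriv_def complex_bump_of_real)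

lemma bump_bounds: "bump p q x \<le> 1" "0 < bump p q x"
  by (auto simp: bump_def)

text \<open>
  After \<open>m\<close> summations by parts the sum is at most
  \<open>(N + m) (b m^{1+1/r} / y)^m\<close> where \<open>y = N \<bar>1 - z\<bar>\<close>. The right side is smallest for \<open>m\<close>
  near \<open>y^{1/(1+1/r)}\<close>, and this choice produces the stretched exponential.
\<close>

lemma bump_exponential_sum:
  assumes "0 < p" "0 < q"
  obtains c where "0 < c"
    "\<And>N z. 1 \<le> N \<Longrightarrow> cmod z = 1 \<Longrightarrow> cmod (\<Sum>n<N. bump_deriv p q 0 (real n / real N) * z ^ n)
       \<le> 6 * real N * exp (- c * (real N * cmod (1 - z)) powr (1 / (1 + 1 / min p q)))"
proof -
  obtain b where b: "1 \<le> b"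
    "\<And>m x. 1 \<le> m \<Longrightarrow> cmod (bump_deriv p q m x) \<le> (b * real m powr (1 + 1 / min p q)) ^ m"
    using bump_deriv_gevrey[OF assms] by blast
  define a where "a = 1 + 1 / min p q"
  have a: "1 < a" using assms by (simp add: a_def)
  define \<beta> where "\<beta> = 1 / a"
  have \<beta>: "0 < \<beta>" "\<beta> < 1" using a by (auto simp: \<beta>_def)
  define e where "e = exp (1::real)"
  have e: "2 \<le> e" "e < 3" using exp_le e_less_272 exp_ge_add_one_self[of 1] by (auto simp: e_def)
  define c where "c = (1 / (e * b)) powr \<beta>"
  have c: "0 < c" using b e by (auto simp: c_def)
  have "cmod (\<Sum>n<N. bump_deriv p q 0 (real n / real N) * z ^ n)
       \<le> 6 * real N * exp (- c * (real N * cmod (1 - z)) powr \<beta>)"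
    if N: "1 \<le> N" and z: "cmod z = 1" for N z
  proof -
    define S where "S = (\<Sum>n<N. bump_deriv p q 0 (real n / real N) * z ^ n)"
    define y where "y = real N * cmod (1 - z)"
    define Y where "Y = c * y powr \<beta>"
    have y0: "0 \<le> y" by (simp add: y_def)
    have Y: "Y = (y / (e * b)) powr \<beta>"
      unfolding Y_def c_def using b e y0 by (subst powr_mult [symmetric]) auto
    have "cmod (1 - z) \<le> 2" using norm_triangle_ineq4[of 1 z] z by simp
    then have "y \<le> 2 * real N" unfolding y_def using mult_left_mono[of "cmod (1 - z)" 2 "real N"] by simp
    moreover have "2 * 1 \<le> e * b" using b e by (intro mult_mono) auto
    then have "real N * 2 \<le> real N * (e * b)" by (intro mult_left_mono) auto
    ultimately have yN: "y / (e * b) \<le> real N"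
      using b e by (simp add: pos_divide_le_eq)
    have YN: "Y \<le> real N"
    proof -
      have "Y \<le> real N powr \<beta>" unfolding Y using \<beta> yN y0 b e by (intro powr_mono2) auto
      also have "\<dots> \<le> real N powr 1" using \<beta> N by (intro powr_mono) auto
      finally show ?thesis using N by simp
    qed
    show ?thesis
    \<comment> \<open>when \<open>Y < 1\<close> no difference can be afforded, and counting terms is enough\<close>
    proof (cases "1 \<le> Y")
      case False
      have "cmod S \<le> (\<Sum>n<N. 1)" unfolding S_def
        by (intro sum_norm_le) (auto simp: norm_mult norm_power z bump_deriv_0 bump_bounds less_imp_le)
      also have "\<dots> \<le> 6 * real N * exp (- 1)"
        using N e by (simp add: exp_minus e_def [symmetric] field_simps)
      also have "\<dots> \<le> 6 * real N * exp (- Y)" using False by (intro mult_left_mono) auto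
      finally show ?thesis by (simp add: S_def Y_def y_def)
    next
      case True
      \<comment> \<open>with this number of differences every one of them gains at least a factor \<open>exp 1\<close>\<close>
      define m where "m = nat \<lfloor>Y\<rfloor>"
      have m: "1 \<le> m" "real m \<le> Y" "Y < real m + 1" using True by (auto simp: m_def le_nat_iff of_nat_floor)
      have y: "0 < y" using True y0 by (cases "y = 0") (auto simp: Y)
      have "real m powr a \<le> (y / (e * b))"
      proof -
        have "real m powr a \<le> Y powr a" using m a by (intro powr_mono2) auto
        also have "\<dots> = y / (e * b)" unfolding Y using a y e b by (simp add: powr_powr \<beta>_def)
        finally show ?thesis .
      qed
      then have my: "b * real m powr a / y \<le> 1 / e"
        using y e b by (simp add: field_simps)
      have "cmod ((1 - z) ^ m * S) = cmod (\<Sum>n<N + m. backward_diff (1 / real N) m (bump_deriv p q 0) (real n / real N) * z ^ n)"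
        unfolding S_def using N by (subst exponential_sum_summation_by_parts) (auto simp: bump_deriv_0)
      also have "\<dots> \<le> (\<Sum>n<N + m. (1 / real N) ^ m * (b * real m powr a) ^ m)"
      proof (intro sum_norm_le)
        fix n
        have "cmod (backward_diff (1 / real N) m (bump_deriv p q 0) (real n / real N)) \<le> (1 / real N) ^ m * (b * real m powr a) ^ m"
          using b(2)[OF m(1)] by (intro norm_backward_diff_le bump_deriv_has_vector_derivative assms) (auto simp: a_def)
        then show "cmod (backward_diff (1 / real N) m (bump_deriv p q 0) (real n / real N) * z ^ n) \<le> (1 / real N) ^ m * (b * real m powr a) ^ m"
          by (simp add: norm_mult norm_power z)
      qed
      also have "\<dots> = real (N + m) * ((b * real m powr a) / real N) ^ m"
        by (simp add: power_divide)
      finally have "cmod (1 - z) ^ m * cmod S \<le> real (N + m) * ((b * real m powr a) / real N) ^ m"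
        by (simp add: norm_mult norm_power)
      then have "cmod S \<le> real (N + m) * ((b * real m powr a) / real N) ^ m / cmod (1 - z) ^ m"
        using y by (subst pos_le_divide_eq) (auto simp: y_def zero_less_mult_iff mult.commute)
      also have "\<dots> = real (N + m) * ((b * real m powr a) / y) ^ m"
        by (simp add: y_def power_divide power_mult_distrib)
      also have "\<dots> \<le> (2 * real N) * (1 / e) ^ m"
        using my m YN b y by (intro mult_mono power_mono) auto
      also have "(1 / e) ^ m = exp (- real m)"
        by (simp add: e_def exp_of_nat_mult [symmetric] exp_minus power_one_over field_simps)
      also have "\<dots> \<le> exp (1 - Y)" using m by simp
      also have "exp (1 - Y) \<le> 3 * exp (- Y)" using e by (simp add: exp_diff e_def [symmetric] exp_minus field_simps)
      finally show ?thesis using N by (simp add: S_def Y_def y_def)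
    qed
  qed
  then show ?thesis using that[of c] c by (simp add: \<beta>_def a_def)
qed

section \<open>Weighted averages of a character\<close>

lemma bump_integral_pos: "0 < (LBINT s:{0<..<1}. bump p q s)"
proof -
  let ?f = "\<lambda>s. indicator {0<..<1} s *\<^sub>R bump p q s"
  have meas [measurable]: "bump p q \<in> borel_measurable borel"
    unfolding bump_def by measurable
  have int: "integrable lborel ?f"
  proof (rule Bochner_Integration.integrable_bound)
    show "integrable lborel (indicator {0<..<1} :: real \<Rightarrow> real)" by simp
  qed (use bump_bounds[of p q] in \<open>auto simp: indicator_def abs_of_pos intro!: AE_I2\<close>)
  have nn: "AE s in lborel. 0 \<le> ?f s"
    using bump_bounds[of p q] by (auto simp: indicator_def intro!: AE_I2 less_imp_le)
  have "integral\<^sup>L lborel ?f \<noteq> 0"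
  proof
    assume "integral\<^sup>L lborel ?f = 0"
    then have "AE s in lborel. ?f s = 0"
      using integral_nonneg_eq_0_iff_AE[OF int nn] by simp
    then have "AE s in lborel. s \<notin> {0<..<1::real}"
      by eventually_elim (use bump_bounds(2)[of p q] in \<open>auto simp: indicator_def split: if_splits\<close>, metis less_irrefl)
    then have "emeasure lborel {0<..<1::real} = 0"
      by (subst (asm) AE_iff_measurable[of "{0<..<1}"]) auto
    then show False by simp
  qed
  moreover have "0 \<le> integral\<^sup>L lborel ?f" using nn by (rule integral_nonneg_AE)
  ultimately show ?thesis by (simp add: set_lebesgue_integral_def)
qed

lemma weight_eq_bump_deriv:
  "complex_of_real (weight p q x) = of_real (inverse (LBINT s:{0<..<1}. bump p q s)) * bump_deriv p q 0 x"
  by (auto simp: weight_def bump_deriv_0)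

lemma weight_nonneg: "0 \<le> weight p q x"
  using bump_integral_pos[of p q] bump_bounds(2)[of p q x] by (auto simp: weight_def)

text \<open>
  One term suffices: the sample point \<open>(N div 2) / N\<close> always lies in \<open>[1/3, 1/2]\<close>. This
  loses a factor \<open>N\<close> against the true order of the sum, which is harmless next to a
  stretched exponential.
\<close>

lemma weight_total_lower:
  assumes "0 < p" "0 < q"
  obtains b where "0 < b" "\<And>N. 2 \<le> N \<Longrightarrow> b \<le> weight_total p q N"
proof -
  define I where "I = inverse (LBINT s:{0<..<1}. bump p q s)"
  have I: "0 < I" using bump_integral_pos[of p q] by (simp add: I_def)
  define b where "b = I * exp (- ((1/3) powr (- p) * (1/2) powr (- q)))"
  have "b \<le> weight_total p q N" if N: "2 \<le> N" for N
  proof -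
    define x where "x = real (N div 2) / real N"
    have "2 * (N div 2) \<le> N" "N \<le> 3 * (N div 2)" using N by auto
    then have "2 * real (N div 2) \<le> real N" "real N \<le> 3 * real (N div 2)"
      by (metis of_nat_le_iff of_nat_mult of_nat_numeral)+
    then have x: "1/3 \<le> x" "x \<le> 1/2" using N by (auto simp: x_def field_simps)
    have "x powr (- p) \<le> (1/3) powr (- p)" "(1 - x) powr (- q) \<le> (1/2) powr (- q)"
      using x assms by (auto intro!: powr_mono2')
    then have "x powr (- p) * (1 - x) powr (- q) \<le> (1/3) powr (- p) * (1/2) powr (- q)"
      by (intro mult_mono) auto
    then have "b \<le> I * bump p q x" using I by (simp add: b_def bump_def)
    also have "\<dots> = weight p q x" using x by (simp add: weight_def I_def)
    also have "\<dots> \<le> weight_total p q N"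
      unfolding weight_total_def x_def using N weight_nonneg
      by (intro member_le_sum[of "N div 2"]) auto
    finally show ?thesis .
  qed
  moreover have "0 < b" using I by (simp add: b_def)
  ultimately show ?thesis using that by blast
qed

lemma weight_sum_shift:
  assumes "1 \<le> N"
  shows "(\<Sum>n<N. of_real (weight p q (real n / real N)) * f n)
     = (\<Sum>n = 1..N - 1. of_real (weight p q (real n / real N)) * (f n :: complex))"
proof -
  have "{..<N} = insert 0 {1..N - 1}" using assms by auto
  then show ?thesis by (simp add: weight_def)
qed

text \<open>
  The weighted Birkhoff average of the character \<open>n \<mapsto> z ^ n\<close>.
\<close>

definition weighted_avg :: "real \<Rightarrow> real \<Rightarrow> nat \<Rightarrow> complex \<Rightarrow> complex" where
  "weighted_avg p q N z = of_real (1 / weight_total p q N) *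
     (\<Sum>n = 1..N - 1. of_real (weight p q (real n / real N)) * z ^ n)"

lemma weight_total_pos:
  assumes "0 < p" "0 < q" "2 \<le> N"
  shows "0 < weight_total p q N"
  using weight_total_lower[OF assms(1,2)] assms(3) by (metis less_le_trans)

lemma weighted_avg_1:
  assumes "0 < p" "0 < q" "2 \<le> N"
  shows "weighted_avg p q N 1 = 1"
proof -
  have "(\<Sum>n = 1..N - 1. complex_of_real (weight p q (real n / real N)) * 1 ^ n) = of_real (weight_total p q N)"
    using weight_sum_shift[of N p q "\<lambda>n. 1"] assms(3) by (simp add: weight_total_def)
  then show ?thesis using weight_total_pos[OF assms] unfolding weighted_avg_def by simp
qed

lemma weighted_avg_le_1:
  assumes "0 < p" "0 < q" "2 \<le> N" "cmod z = 1"
  shows "cmod (weighted_avg p q N z) \<le> 1"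
proof -
  have "cmod (\<Sum>n = 1..N - 1. of_real (weight p q (real n / real N)) * z ^ n)
      \<le> (\<Sum>n<N. weight p q (real n / real N))"
    unfolding weight_sum_shift[symmetric, OF order_trans[OF one_le_numeral assms(3)]]
    using weight_nonneg assms(4) by (intro sum_norm_le) (auto simp: norm_mult norm_power)
  moreover have "cmod (weighted_avg p q N z) = 1 / weight_total p q N *
      cmod (\<Sum>n = 1..N - 1. of_real (weight p q (real n / real N)) * z ^ n)"
    using weight_total_pos[OF assms(1-3)] by (simp add: weighted_avg_def norm_mult norm_divide)
  ultimately show ?thesis
    using weight_total_pos[OF assms(1-3)] by (simp add: weight_total_def[symmetric] divide_le_eq)
qed

lemma weighted_avg_decay:
  assumes "0 < p" "0 < q"
  obtains c C where "0 < c" "0 < C"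
    "\<And>N z. 2 \<le> N \<Longrightarrow> cmod z = 1 \<Longrightarrow> cmod (weighted_avg p q N z)
       \<le> C * real N * exp (- c * (real N * cmod (1 - z)) powr (1 / (1 + 1 / min p q)))"
proof -
  obtain c where c: "0 < c"
    "\<And>N z. 1 \<le> N \<Longrightarrow> cmod z = 1 \<Longrightarrow> cmod (\<Sum>n<N. bump_deriv p q 0 (real n / real N) * z ^ n)
       \<le> 6 * real N * exp (- c * (real N * cmod (1 - z)) powr (1 / (1 + 1 / min p q)))"
    using bump_exponential_sum[OF assms] by blast
  obtain b where b: "0 < b" "\<And>N. 2 \<le> N \<Longrightarrow> b \<le> weight_total p q N"
    using weight_total_lower[OF assms] by blast
  define I where "I = inverse (LBINT s:{0<..<1}. bump p q s)"
  have I: "0 < I" using bump_integral_pos[of p q] by (simp add: I_def)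
  have "cmod (weighted_avg p q N z)
       \<le> (1 / b) * I * 6 * real N * exp (- c * (real N * cmod (1 - z)) powr (1 / (1 + 1 / min p q)))"
    if N: "2 \<le> N" and z: "cmod z = 1" for N z
  proof -
    define E where "E = 6 * real N * exp (- c * (real N * cmod (1 - z)) powr (1 / (1 + 1 / min p q)))"
    have "(\<Sum>n = 1..N - 1. of_real (weight p q (real n / real N)) * z ^ n)
        = of_real I * (\<Sum>n<N. bump_deriv p q 0 (real n / real N) * z ^ n)"
      using N by (subst weight_sum_shift [symmetric])
        (auto simp: weight_eq_bump_deriv I_def sum_distrib_left mult_ac)
    then have "cmod (weighted_avg p q N z) = 1 / weight_total p q N * (I * cmod (\<Sum>n<N. bump_deriv p q 0 (real n / real N) * z ^ n))"
      using I weight_total_pos[OF assms N] by (simp add: weighted_avg_def norm_mult norm_divide)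
    also have "\<dots> \<le> 1 / b * (I * E)"
      using I b N c(2)[of N z] z weight_total_pos[OF assms N]
      by (intro mult_mono mult_left_mono divide_left_mono) (auto simp: E_def)
    finally show ?thesis by (simp add: E_def mult_ac)
  qed
  then show ?thesis using that[of c "(1 / b) * I * 6"] c b I by auto
qed

section \<open>Integer frequencies\<close>

definition supp :: "(int \<Rightarrow> int) \<Rightarrow> int set" where
  "supp k = {j. k j \<noteq> 0}"

text \<open>
  The weight of a coordinate in \<^const>\<open>freq_norm\<close>, so that both dimensions can be treated
  by the same finite sum over the support.
\<close>

definition site_weight :: "nat \<Rightarrow> int set \<Rightarrow> int \<Rightarrow> real" where
  "site_weight \<eta> J j = (if finite J then 1 else real_of_int (bracket j ^ \<eta>))"

lemma bracket_ge_1: "1 \<le> bracket j"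
  by (simp add: bracket_def)

lemma site_weight_ge_1: "1 \<le> site_weight \<eta> J j"
  using bracket_ge_1[of j] by (simp add: site_weight_def one_le_power)

lemma site_weight_nonneg: "0 \<le> site_weight \<eta> J j"
  using site_weight_ge_1[of \<eta> J j] by linarith

text \<open>
  In infinitely many variables the nonzero terms of the norm are at least 1, so that a
  summable integer vector has finite support. Every later statement about frequencies reduces
  to finite sums in this way.
\<close>

lemma freqs_iff: "k \<in> freqs \<eta> J \<longleftrightarrow> finite (supp k) \<and> supp k \<subseteq> J"
proof
  assume k: "k \<in> freqs \<eta> J"
  then have sub: "supp k \<subseteq> J" by (auto simp: freqs_def supp_def)
  have "finite (supp k)"
  proof (cases "finite J")
    case True then show ?thesis using sub finite_subset by blast
  next
    case False
    then have "(\<lambda>j. real_of_int (bracket j ^ \<eta> * \<bar>k j\<bar>)) summable_on J" using k by (simp add: freqs_def)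
    then have s: "(\<lambda>j. real_of_int (bracket j ^ \<eta> * \<bar>k j\<bar>)) summable_on supp k"
      using sub summable_on_subset_banach by blast
    have "(\<lambda>j. 1::real) summable_on supp k"
    proof (rule summable_on_comparison_test[OF s])
      fix j assume "j \<in> supp k"
      then have "1 * 1 \<le> bracket j ^ \<eta> * \<bar>k j\<bar>"
        using bracket_ge_1[of j] by (intro mult_mono) (auto simp: supp_def one_le_power)
      then show "1 \<le> real_of_int (bracket j ^ \<eta> * \<bar>k j\<bar>)" by linarith
    qed auto
    then have "real (card G) \<le> (\<Sum>\<^sub>\<infinity>j\<in>supp k. 1)" if "G \<subseteq> supp k" "finite G" for G
      using finite_sum_le_infsum[of "\<lambda>j. 1::real" "supp k" G] that by simp
    then have "card G \<le> nat \<lfloor>\<Sum>\<^sub>\<infinity>j\<in>supp k. 1::real\<rfloor>" if "G \<subseteq> supp k" "finite G" for G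
      using that by (simp add: le_nat_floor)
    then show ?thesis using finite_if_finite_subsets_card_bdd by blast
  qed
  then show "finite (supp k) \<and> supp k \<subseteq> J" using sub by simp
next
  assume k: "finite (supp k) \<and> supp k \<subseteq> J"
  then have "(\<lambda>j. real_of_int (bracket j ^ \<eta> * \<bar>k j\<bar>)) summable_on J"
    by (subst summable_on_cong_neutral[of "supp k" J _ "\<lambda>j. real_of_int (bracket j ^ \<eta> * \<bar>k j\<bar>)"])
      (auto simp: supp_def)
  then show "k \<in> freqs \<eta> J" using k by (auto simp: freqs_def supp_def)
qed

lemma pairing_eq_sum:
  assumes "finite A" "supp k \<subseteq> A" "A \<subseteq> J"
  shows "pairing J k x = (\<Sum>j\<in>A. of_int (k j) * x j)"
proof -
  have "pairing J k x = (\<Sum>\<^sub>\<infinity>j\<in>A. of_int (k j) * x j)"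
    unfolding pairing_def by (rule infsum_cong_neutral) (use assms in \<open>auto simp: supp_def\<close>)
  then show ?thesis using assms(1) by simp
qed

lemma freq_norm_eq_sum:
  assumes "finite A" "supp k \<subseteq> A" "A \<subseteq> J"
  shows "freq_norm \<eta> J k = (\<Sum>j\<in>A. site_weight \<eta> J j * \<bar>real_of_int (k j)\<bar>)"
proof (cases "finite J")
  case True
  then show ?thesis using assms unfolding freq_norm_def l1_norm_def site_weight_def
    by (auto intro!: sum.mono_neutral_right simp: supp_def)
next
  case False
  have "eta_norm \<eta> J k = (\<Sum>\<^sub>\<infinity>j\<in>A. real_of_int (bracket j ^ \<eta> * \<bar>k j\<bar>))"
    unfolding eta_norm_def by (rule infsum_cong_neutral) (use assms in \<open>auto simp: supp_def\<close>)
  then show ?thesis using assms(1) False by (simp add: freq_norm_def site_weight_def)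
qed

lemma supp_diff: "supp (\<lambda>j. k j - s j) \<subseteq> supp k \<union> supp s"
  by (auto simp: supp_def)

lemma freqs_diff:
  assumes "k \<in> freqs \<eta> J" "s \<in> freqs \<eta> J"
  shows "(\<lambda>j. k j - s j) \<in> freqs \<eta> J"
  using assms supp_diff[of k s] by (auto simp: freqs_iff intro: finite_subset)

lemma pairing_diff:
  assumes "k \<in> freqs \<eta> J" "s \<in> freqs \<eta> J"
  shows "pairing J (\<lambda>j. k j - s j) x = pairing J k x - pairing J s x"
  using assms supp_diff[of k s]
  by (subst (1 2 3) pairing_eq_sum[of "supp k \<union> supp s"])
    (auto simp: freqs_iff sum_subtractf [symmetric] algebra_simps)

lemma pairing_add:
  assumes "k \<in> freqs \<eta> J"
  shows "pairing J k (\<lambda>j. x j + y j) = pairing J k x + pairing J k y"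
  using assms by (subst (1 2 3) pairing_eq_sum[of "supp k"]) (auto simp: freqs_iff sum.distrib algebra_simps)

lemma pairing_scale:
  assumes "k \<in> freqs \<eta> J"
  shows "pairing J k (\<lambda>j. c * x j) = c * pairing J k x"
  using assms by (subst (1 2) pairing_eq_sum[of "supp k"]) (auto simp: freqs_iff sum_distrib_left algebra_simps)

lemma pairing_of_real:
  assumes "k \<in> freqs \<eta> J"
  shows "pairing J k (\<lambda>j. complex_of_real (x j)) = of_real (pairing J k x)"
  using assms by (subst (1 2) pairing_eq_sum[of "supp k"]) (auto simp: freqs_iff)

lemma freq_norm_nonneg:
  assumes "k \<in> freqs \<eta> J"
  shows "0 \<le> freq_norm \<eta> J k"
  using assms by (subst freq_norm_eq_sum[of "supp k"])
    (auto simp: freqs_iff site_weight_nonneg intro!: sum_nonneg)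

lemma freq_norm_diff:
  assumes "k \<in> freqs \<eta> J" "s \<in> freqs \<eta> J"
  shows "freq_norm \<eta> J (\<lambda>j. k j - s j) \<le> freq_norm \<eta> J k + freq_norm \<eta> J s"
proof -
  have A: "finite (supp k \<union> supp s)" "supp k \<union> supp s \<subseteq> J" using assms by (auto simp: freqs_iff)
  show ?thesis
    using supp_diff[of k s] site_weight_nonneg
    by (subst (1 2 3) freq_norm_eq_sum[OF A(1) _ A(2)])
      (auto simp: sum.distrib [symmetric] distrib_left [symmetric] intro!: sum_mono mult_left_mono)
qed

lemma term_le_freq_norm:
  assumes "k \<in> freqs \<eta> J" "j \<in> supp k"
  shows "site_weight \<eta> J j * \<bar>real_of_int (k j)\<bar> \<le> freq_norm \<eta> J k"
  using assms site_weight_nonneg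
  by (subst freq_norm_eq_sum[of "supp k"])
    (auto simp: freqs_iff intro!: member_le_sum[where f="\<lambda>j. site_weight \<eta> J j * \<bar>real_of_int (k j)\<bar>"])

lemma freq_norm_ge_1:
  assumes "k \<in> freqs \<eta> J" "k \<noteq> (\<lambda>j. 0)"
  shows "1 \<le> freq_norm \<eta> J k"
proof -
  obtain j where j: "j \<in> supp k" using assms(2) by (auto simp: supp_def)
  then have "1 \<le> \<bar>real_of_int (k j)\<bar>" by (simp add: supp_def)
  then have "1 * 1 \<le> site_weight \<eta> J j * \<bar>real_of_int (k j)\<bar>"
    using site_weight_ge_1[of \<eta> J j] by (intro mult_mono) auto
  then show ?thesis using term_le_freq_norm[OF assms(1) j] by simp
qed

lemma countable_freqs: "countable (freqs \<eta> J)"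
proof -
  have "freqs \<eta> J \<subseteq> {k. finite (supp k)}" by (auto simp: freqs_iff)
  moreover have "countable {k :: int \<Rightarrow> int. finite (supp k)}"
  proof (rule countable_subset)
    let ?g = "\<lambda>(xs :: (int \<times> int) list) j. case map_of xs j of None \<Rightarrow> 0 | Some v \<Rightarrow> v"
    show "{k :: int \<Rightarrow> int. finite (supp k)} \<subseteq> range ?g"
    proof
      fix k :: "int \<Rightarrow> int" assume "k \<in> {k. finite (supp k)}"
      then obtain js where js: "set js = supp k" using finite_list by auto
      have "k = ?g (map (\<lambda>j. (j, k j)) js)"
      proof
        fix j show "k j = ?g (map (\<lambda>j. (j, k j)) js) j"
          using js by (auto simp: map_of_map_restrict supp_def restrict_map_def)
      qed
      then show "k \<in> range ?g" by blast
    qed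
  qed simp
  ultimately show ?thesis using countable_subset by blast
qed

section \<open>Small measure of near resonances\<close>

lemma half_le_sin:
  fixes u :: real
  assumes "0 \<le> u" "u \<le> pi / 2"
  shows "u / 2 \<le> sin u"
proof (cases "u = 0")
  case False
  define v where "v = u / 2"
  have v: "0 < v" "v \<le> pi / 4" using assms False by (auto simp: v_def)
  have cv: "sqrt 2 / 2 \<le> cos x" if "0 \<le> x" "x \<le> v" for x
    using cos_monotone_0_pi_le[of x "pi/4"] that v by (simp add: cos_45)
  obtain \<xi> where \<xi>: "0 < \<xi>" "\<xi> < v" "sin v - sin 0 = (v - 0) * cos \<xi>"
    using MVT2[of 0 v sin cos] v by (metis DERIV_sin)
  have "v * (sqrt 2 / 2) \<le> sin v" using \<xi> v cv[of \<xi>] by simp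
  then have "(v * (sqrt 2 / 2)) * (sqrt 2 / 2) \<le> sin v * cos v"
    using v cv[of v] by (intro mult_mono) (auto intro: sin_ge_zero)
  then have "v \<le> 2 * sin v * cos v" by (simp add: mult.assoc)
  then show ?thesis by (simp add: v_def sin_double [symmetric])
qed simp

lemma norm_1_minus_cis: "cmod (1 - cis t) = 2 * \<bar>sin (t / 2)\<bar>"
proof -
  have "(cmod (1 - cis t))\<^sup>2 = (1 - cos t)\<^sup>2 + (sin t)\<^sup>2"
    by (simp add: cmod_power2)
  also have "\<dots> = 2 - 2 * cos t"
    using sin_cos_squared_add[of t] by (simp add: power2_eq_square algebra_simps)
  also have "\<dots> = (2 * \<bar>sin (t / 2)\<bar>)\<^sup>2"
    using cos_double_sin[of "t / 2"] by (simp add: power_mult_distrib)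
  finally show ?thesis by (rule power2_eq_imp_eq) auto
qed

text \<open>
  The distance of \<open>cis (2 * pi * x)\<close> from 1 controls the distance of \<open>x\<close> to the integers.
  The former is used to measure resonance since it enters the exponential sums directly.
\<close>

lemma dist_int_le_chord:
  fixes x :: real
  shows "\<exists>n::int. \<bar>x - of_int n\<bar> \<le> cmod (1 - cis (2 * pi * x))"
proof
  define y where "y = x - of_int (round x)"
  have y: "\<bar>y\<bar> \<le> 1/2" using of_int_round_abs_le[of x] by (simp add: y_def abs_minus_commute)
  have "cis (2 * pi * x) = cis (2 * pi * y) * cis (2 * pi * of_int (round x))"
    by (simp add: cis_mult y_def algebra_simps)
  also have "\<dots> = cis (2 * pi * y)" by (simp add: cis_multiple_2pi)
  finally have "cmod (1 - cis (2 * pi * x)) = 2 * \<bar>sin (pi * \<bar>y\<bar>)\<bar>"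
    by (simp add: norm_1_minus_cis abs_if)
  moreover have "pi * \<bar>y\<bar> / 2 \<le> sin (pi * \<bar>y\<bar>)"
    using half_le_sin[of "pi * \<bar>y\<bar>"] mult_left_mono[OF y pi_ge_zero] by (simp add: field_simps)
  ultimately have "pi * \<bar>y\<bar> \<le> cmod (1 - cis (2 * pi * x))" by simp
  moreover have "\<bar>y\<bar> \<le> pi * \<bar>y\<bar>" using pi_ge_two mult_right_mono[of 1 pi "\<bar>y\<bar>"] by simp
  ultimately show "\<bar>x - of_int (round x)\<bar> \<le> cmod (1 - cis (2 * pi * x))" by (simp add: y_def)
qed

text \<open>
  As \<open>t\<close> runs through a unit interval, \<open>a t + b\<close> can be near at most \<open>6 \<bar>a\<bar>\<close> integers, and it
  stays within \<open>\<delta>\<close> of each of them on an interval of length \<open>2 \<delta> / \<bar>a\<bar>\<close>. The slope cancels,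
  which makes the bound uniform in \<open>a\<close>.
\<close>

lemma measure_linear_near_integers:
  fixes a :: int and b u \<delta> :: real
  assumes "a \<noteq> 0" "0 \<le> \<delta>"
  shows "emeasure (uniform_measure lborel {u..u+1}) {t. cmod (1 - cis (2 * pi * (of_int a * t + b))) < \<delta>} \<le> ennreal (12 * \<delta>)"
proof -
  define B where "B = {t. cmod (1 - cis (2 * pi * (of_int a * t + b))) < \<delta>}"
  have "open B" unfolding B_def cis_conv_exp
    by (intro open_Collect_less continuous_intros)
  then have Bm [measurable]: "B \<in> sets lborel" unfolding sets_lborel by (rule borel_open)
  have eq: "emeasure (uniform_measure lborel {u..u+1}) B = emeasure lborel ({u..u+1} \<inter> B)"
    using Bm by (subst emeasure_uniform_measure) (auto simp: divide_ennreal_def)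
  show ?thesis
  proof (cases "\<delta> \<le> 1/2")
    case False
    have "emeasure lborel ({u..u+1} \<inter> B) \<le> emeasure lborel {u..u+1}" by (intro emeasure_mono) auto
    also have "\<dots> = ennreal 1" by simp
    also have "\<dots> \<le> ennreal (12 * \<delta>)" using False by (intro ennreal_leI) auto
    finally show ?thesis using eq by (simp add: B_def)
  next
    case True
    define v where "v = of_int a * u + b"
    \<comment> \<open>all integers within distance \<open>\<bar>a\<bar> + 1/2\<close> of the value \<open>v\<close> at the left endpoint\<close>
    define S where "S = {\<lfloor>v\<rfloor> - \<bar>a\<bar> - 1 .. \<lfloor>v\<rfloor> + \<bar>a\<bar> + 2}"
    define I where "I n = {(of_int n - b) / of_int a - \<delta> / \<bar>of_int a\<bar> .. (of_int n - b) / of_int a + \<delta> / \<bar>real_of_int a\<bar>}" for n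
    have "{u..u+1} \<inter> B \<subseteq> (\<Union>n\<in>S. I n)"
    proof
      fix t assume t: "t \<in> {u..u+1} \<inter> B"
      obtain n :: int where "\<bar>of_int a * t + b - of_int n\<bar> \<le> cmod (1 - cis (2 * pi * (of_int a * t + b)))"
        using dist_int_le_chord[of "of_int a * t + b"] by blast
      moreover have "cmod (1 - cis (2 * pi * (of_int a * t + b))) < \<delta>" using t by (simp add: B_def)
      ultimately have n: "\<bar>of_int a * t + b - of_int n\<bar> \<le> \<delta>" by linarith
      have "\<bar>of_int a * t + b - v\<bar> \<le> \<bar>of_int a\<bar>"
      proof -
        have "\<bar>of_int a * t + b - v\<bar> = \<bar>real_of_int a\<bar> * \<bar>t - u\<bar>"
          by (simp add: v_def abs_mult [symmetric] algebra_simps)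
        also have "\<dots> \<le> \<bar>of_int a\<bar> * 1" using t by (intro mult_left_mono) auto
        finally show ?thesis by simp
      qed
      then have "\<bar>of_int n - v\<bar> \<le> of_int \<bar>a\<bar> + 1/2" using n True by simp
      then have "n \<in> S" unfolding S_def by (simp; linarith)
      moreover have "\<bar>t - (of_int n - b) / of_int a\<bar> \<le> \<delta> / \<bar>of_int a\<bar>"
      proof -
        have "t - (of_int n - b) / of_int a = (of_int a * t + b - of_int n) / of_int a"
          using assms by (simp add: field_simps)
        then show ?thesis using n by (simp add: divide_right_mono)
      qed
      then have "t \<in> I n" unfolding I_def by (simp add: abs_le_iff; linarith)
      ultimately show "t \<in> (\<Union>n\<in>S. I n)" by blast
    qed
    then have "emeasure lborel ({u..u+1} \<inter> B) \<le> emeasure lborel (\<Union>n\<in>S. I n)"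
      by (intro emeasure_mono) (auto simp: S_def I_def intro!: sets.finite_UN)
    also have "\<dots> \<le> (\<Sum>n\<in>S. emeasure lborel (I n))"
      by (intro emeasure_subadditive_finite) (auto simp: S_def I_def)
    also have "\<dots> = (\<Sum>n\<in>S. ennreal (2 * \<delta> / \<bar>of_int a\<bar>))"
      using assms by (intro sum.cong) (auto simp: I_def)
    also have "\<dots> = ennreal (real (card S) * (2 * \<delta> / \<bar>of_int a\<bar>))"
      using assms by (simp only: sum_constant ennreal_of_nat_eq_real_of_nat, intro ennreal_mult [symmetric]) auto
    also have "\<dots> \<le> ennreal (12 * \<delta>)"
    proof (rule ennreal_leI)
      have "card S = nat (2 * \<bar>a\<bar> + 4)" by (simp add: S_def)
      moreover have "2 * \<bar>a\<bar> + 4 \<le> 6 * \<bar>a\<bar>" using assms by linarith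
      ultimately have "real (card S) \<le> 6 * \<bar>of_int a\<bar>" by simp
      then have "real (card S) * (2 * \<delta> / \<bar>of_int a\<bar>) \<le> 6 * \<bar>of_int a\<bar> * (2 * \<delta> / \<bar>of_int a\<bar>)"
        using assms by (intro mult_right_mono) auto
      also have "\<dots> = 12 * \<delta>" using assms by simp
      finally show "real (card S) * (2 * \<delta> / \<bar>of_int a\<bar>) \<le> 12 * \<delta>" .
    qed
    finally show ?thesis using eq by (simp add: B_def)
  qed
qed

definition phase :: "int set \<Rightarrow> (int \<Rightarrow> int) \<Rightarrow> (int \<Rightarrow> real) \<Rightarrow> complex" where
  "phase J k x = cis (2 * pi * pairing J k x)"

lemma prob_space_unit_uniform: "prob_space (uniform_measure lborel {u..u+1::real})"
  by (rule prob_space_uniform_measure) auto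

lemma measurable_phase:
  assumes "k \<in> freqs \<eta> J" "\<And>j. sets (M j) = sets borel"
  shows "phase J k \<in> borel_measurable (PiM J M)"
proof -
  have "phase J k = (\<lambda>x. cis (2 * pi * (\<Sum>j\<in>supp k. of_int (k j) * x j)))"
    using assms(1) by (auto simp: phase_def fun_eq_iff freqs_iff pairing_eq_sum[of "supp k"])
  moreover have "(\<lambda>x. x j) \<in> borel_measurable (PiM J M)" if "j \<in> supp k" for j
  proof -
    have "j \<in> J" using that assms(1) by (auto simp: freqs_iff)
    then show ?thesis using measurable_component_singleton[of j J M] assms(2)[of j] measurable_cong_sets by blast
  qed
  ultimately show ?thesis
    unfolding cis_conv_exp by (auto intro!: measurable_compose[OF _ borel_measurable_exp] borel_measurable_times borel_measurable_sum borel_measurable_of_real)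
qed

text \<open>
  Fubini in one coordinate \<open>j\<close> with \<open>k j \<noteq> 0\<close>: for fixed values of the other coordinates the
  pairing is a linear function of the \<open>j\<close>-th one with nonzero integer slope.
\<close>

lemma measure_near_resonance:
  fixes u \<delta> :: real
  assumes k: "k \<in> freqs \<eta> J" "k \<noteq> (\<lambda>j. 0)" and "0 \<le> \<delta>"
  defines "M \<equiv> PiM J (\<lambda>_. uniform_measure lborel {u..u+1})"
  shows "{x \<in> space M. cmod (1 - phase J k x) < \<delta>} \<in> sets M"
    and "emeasure M {x \<in> space M. cmod (1 - phase J k x) < \<delta>} \<le> ennreal (12 * \<delta>)"
proof -
  let ?U = "\<lambda>_::int. uniform_measure lborel {u..u+1::real}"
  have [measurable]: "phase J k \<in> borel_measurable M"
    unfolding M_def using k(1) by (rule measurable_phase) simp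
  show A: "{x \<in> space M. cmod (1 - phase J k x) < \<delta>} \<in> sets M" by measurable
  obtain j where j: "j \<in> supp k" using k(2) by (auto simp: supp_def)
  have jJ: "j \<in> J" "supp k \<subseteq> J" "finite (supp k)" using j k(1) by (auto simp: freqs_iff)
  define M' where "M' = PiM (J - {j}) ?U"
  interpret U: prob_space "?U j" by (rule prob_space_unit_uniform)
  interpret M': prob_space M' unfolding M'_def by (intro prob_space_PiM prob_space_unit_uniform)
  interpret P: pair_prob_space "?U j" M' ..
  let ?T = "\<lambda>(x, X). X(j := x)"
  have J: "insert j (J - {j}) = J" using jJ by auto
  have D: "distr (?U j \<Otimes>\<^sub>M M') M ?T = M"
    using distr_pair_PiM_eq_PiM[of "J - {j}" ?U j] prob_space_unit_uniform
    unfolding M'_def M_def J by blast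
  have T: "?T \<in> measurable (?U j \<Otimes>\<^sub>M M') M"
  proof -
    have "(\<lambda>(X, x). X(j := x)) \<in> measurable (M' \<Otimes>\<^sub>M ?U j) M"
      using measurable_add_dim[of j "J - {j}" ?U] unfolding M'_def M_def J .
    then have "(\<lambda>w. (\<lambda>(X, x). X(j := x)) (snd w, fst w)) \<in> measurable (?U j \<Otimes>\<^sub>M M') M"
      by measurable
    then show ?thesis by (simp add: case_prod_unfold)
  qed
  let ?B = "{x \<in> space M. cmod (1 - phase J k x) < \<delta>}"
  have "emeasure M ?B = emeasure (?U j \<Otimes>\<^sub>M M') (?T -` ?B \<inter> space (?U j \<Otimes>\<^sub>M M'))"
    by (subst D[symmetric], subst emeasure_distr[OF T A]) simp
  also have "\<dots> = (\<integral>\<^sup>+ X. emeasure (?U j) ((\<lambda>x. (x, X)) -` (?T -` ?B \<inter> space (?U j \<Otimes>\<^sub>M M'))) \<partial>M')"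
    by (rule P.emeasure_pair_measure_alt2) (use T A in measurable)
  also have "\<dots> \<le> (\<integral>\<^sup>+ X. ennreal (12 * \<delta>) \<partial>M')"
  proof (rule nn_integral_mono)
    fix X :: "int \<Rightarrow> real"
    define b where "b = (\<Sum>i\<in>supp k - {j}. of_int (k i) * X i)"
    have "phase J k (X(j := x)) = cis (2 * pi * (of_int (k j) * x + b))" for x
      unfolding phase_def using jJ j
      by (subst pairing_eq_sum[of "supp k"], simp_all add: b_def sum.remove[of _ j])
    then have "(\<lambda>x. (x, X)) -` (?T -` ?B \<inter> space (?U j \<Otimes>\<^sub>M M')) \<subseteq>
      {t. cmod (1 - cis (2 * pi * (of_int (k j) * t + b))) < \<delta>}" by auto
    then have "emeasure (?U j) ((\<lambda>x. (x, X)) -` (?T -` ?B \<inter> space (?U j \<Otimes>\<^sub>M M')))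
      \<le> emeasure (?U j) {t. cmod (1 - cis (2 * pi * (of_int (k j) * t + b))) < \<delta>}"
      by (rule emeasure_mono) (auto simp: cis_conv_exp intro!: borel_open open_Collect_less continuous_intros)
    also have "\<dots> \<le> ennreal (12 * \<delta>)"
      using j \<open>0 \<le> \<delta>\<close> by (intro measure_linear_near_integers) (auto simp: supp_def)
    finally show "emeasure (?U j) ((\<lambda>x. (x, X)) -` (?T -` ?B \<inter> space (?U j \<Otimes>\<^sub>M M'))) \<le> ennreal (12 * \<delta>)" .
  qed
  also have "\<dots> = ennreal (12 * \<delta>)" by (simp add: M'.emeasure_space_1)
  finally show "emeasure M ?B \<le> ennreal (12 * \<delta>)" .
qed

section \<open>Almost every rotation is nonresonant\<close>

text \<open>
  The size of a frequency that governs its small divisor. Being a product over the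
  coordinates, its negative powers can be summed one coordinate at a time.
\<close>

definition freq_prod :: "(int \<Rightarrow> int) \<Rightarrow> real" where
  "freq_prod k = (\<Prod>j\<in>supp k. real_of_int (bracket j * \<bar>k j\<bar>))"

lemma freq_prod_factor_ge_1: "j \<in> supp k \<Longrightarrow> 1 \<le> real_of_int (bracket j * \<bar>k j\<bar>)"
proof -
  assume "j \<in> supp k"
  then have "1 * 1 \<le> bracket j * \<bar>k j\<bar>"
    using bracket_ge_1[of j] by (intro mult_mono) (auto simp: supp_def)
  then show ?thesis by linarith
qed

lemma freq_prod_ge_1: "1 \<le> freq_prod k"
  unfolding freq_prod_def by (intro prod_ge_1 freq_prod_factor_ge_1)

lemma bracket_powr_sums_bounded:
  fixes \<mu> :: real
  assumes "1 < \<mu>"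
  obtains Z where "0 \<le> Z" "\<And>A. finite A \<Longrightarrow> (\<Sum>m\<in>A. real_of_int (bracket m) powr (- \<mu>)) \<le> Z"
proof -
  have s: "summable (\<lambda>n. real n powr (- \<mu>))" using assms by (simp add: summable_real_powr_iff)
  define Z where "Z = 1 + 2 * (\<Sum>n. real n powr (- \<mu>))"
  have box: "(\<Sum>m\<in>{- int R..int R}. real_of_int (bracket m) powr (- \<mu>)) = 1 + 2 * (\<Sum>n<Suc R. real n powr (- \<mu>))" for R
  proof (induction R)
    case (Suc R)
    have "{- int (Suc R)..int (Suc R)} = insert (- int (Suc R)) (insert (int (Suc R)) {- int R..int R})" by auto
    then show ?case using Suc.IH by (simp add: bracket_def max_def del: of_nat_Suc)
  qed (simp add: bracket_def)
  have "(\<Sum>m\<in>A. real_of_int (bracket m) powr (- \<mu>)) \<le> Z" if A: "finite A" for A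
  proof -
    define R where "R = (\<Sum>a\<in>A. nat \<bar>a\<bar>)"
    have "A \<subseteq> {- int R..int R}"
    proof
      fix a assume "a \<in> A"
      then have "nat \<bar>a\<bar> \<le> R" unfolding R_def using A by (intro member_le_sum) auto
      then show "a \<in> {- int R..int R}" by auto
    qed
    then have "(\<Sum>m\<in>A. real_of_int (bracket m) powr (- \<mu>)) \<le> (\<Sum>m\<in>{- int R..int R}. real_of_int (bracket m) powr (- \<mu>))"
      by (intro sum_mono2) auto
    also have "\<dots> \<le> Z" unfolding box Z_def using sum_le_suminf[OF s, of "{..<Suc R}"] by simp
    finally show ?thesis .
  qed
  moreover have "0 \<le> Z" using suminf_nonneg[OF s] by (simp add: Z_def)
  ultimately show ?thesis using that by blast
qed

text \<open>
  Expanding a product of sums, any finite partial sum is at most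
  \<open>\<Prod>j. (1 + \<Sum>m\<noteq>0. (\<langle>j\<rangle>\<bar>m\<bar>)^{-\<mu>})\<close>, and
  \<open>1 + x \<le> exp x\<close> bounds this by \<open>exp (Z\<^sup>2)\<close>, where \<open>Z\<close> bounds the sums of
  \<open>\<langle>m\<rangle>^{-\<mu>}\<close>. The dimension does not enter.
\<close>

lemma freq_prod_powr_summable:
  fixes \<mu> :: real
  assumes "1 < \<mu>"
  shows "(\<lambda>k. freq_prod k powr (- \<mu>)) summable_on freqs \<eta> J"
proof -
  obtain Z where Z: "0 \<le> Z" "\<And>A. finite A \<Longrightarrow> (\<Sum>m\<in>A. real_of_int (bracket m) powr (- \<mu>)) \<le> Z"
    using bracket_powr_sums_bounded[OF assms] by blast
  have "(\<Sum>k\<in>G. freq_prod k powr (- \<mu>)) \<le> exp (Z * Z)" if G: "finite G" "G \<subseteq> freqs \<eta> J" for G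
  proof -
    define A where "A = (\<Union>k\<in>G. supp k)"
    define R where "R = (\<Sum>k\<in>G. \<Sum>j\<in>A. \<bar>k j\<bar>)"
    define B where "B = {- R..R}"
    define \<phi> where "\<phi> j m = (if m = 0 then 1 else real_of_int (bracket j * \<bar>m\<bar>) powr (- \<mu>))" for j m
    have A: "finite A" using G by (auto simp: A_def freqs_iff)
    have \<phi>0: "0 \<le> \<phi> j m" for j m by (simp add: \<phi>_def)
    have inB: "k j \<in> B" if "k \<in> G" "j \<in> A" for k j
    proof -
      have "\<bar>k j\<bar> \<le> (\<Sum>j\<in>A. \<bar>k j\<bar>)" using that A by (intro member_le_sum) auto
      also have "\<dots> \<le> R" unfolding R_def using that G(1)
        by (intro member_le_sum[of k G "\<lambda>k. \<Sum>j\<in>A. \<bar>k j\<bar>"]) (auto intro: sum_nonneg)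
      finally show ?thesis by (auto simp: B_def)
    qed
    have inj: "inj_on (\<lambda>k. restrict k A) G"
    proof (rule inj_onI)
      fix k l assume kl: "k \<in> G" "l \<in> G" "restrict k A = restrict l A"
      show "k = l"
      proof
        fix j show "k j = l j"
        proof (cases "j \<in> A")
          case True then show ?thesis using kl(3) by (metis restrict_apply')
        next
          case False then have "k j = 0" "l j = 0" using kl(1,2) by (auto simp: A_def supp_def)
          then show ?thesis by simp
        qed
      qed
    qed
    have "freq_prod k powr (- \<mu>) = (\<Prod>j\<in>A. \<phi> j (k j))" if k: "k \<in> G" for k
    proof -
      have "freq_prod k powr (- \<mu>) = (\<Prod>j\<in>supp k. real_of_int (bracket j * \<bar>k j\<bar>) powr (- \<mu>))"
        unfolding freq_prod_def
        by (rule prod_powr_distrib)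
      also have "\<dots> = (\<Prod>j\<in>supp k. \<phi> j (k j))" by (intro prod.cong) (auto simp: \<phi>_def supp_def)
      also have "\<dots> = (\<Prod>j\<in>A. \<phi> j (k j))"
        using k A by (intro prod.mono_neutral_left) (auto simp: A_def \<phi>_def supp_def)
      finally show ?thesis .
    qed
    then have "(\<Sum>k\<in>G. freq_prod k powr (- \<mu>)) = (\<Sum>k\<in>G. \<Prod>j\<in>A. \<phi> j ((restrict k A) j))" by simp
    also have "\<dots> = (\<Sum>g\<in>(\<lambda>k. restrict k A) ` G. \<Prod>j\<in>A. \<phi> j (g j))"
      using inj by (subst sum.reindex) auto
    also have "\<dots> \<le> (\<Sum>g\<in>PiE A (\<lambda>_. B). \<Prod>j\<in>A. \<phi> j (g j))"
      using A inB \<phi>0 by (intro sum_mono2) (auto simp: B_def intro!: prod_nonneg finite_PiE)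
    also have "\<dots> = (\<Prod>j\<in>A. \<Sum>m\<in>B. \<phi> j m)"
      using A by (intro prod_sum_PiE [symmetric]) (auto simp: B_def)
    also have "\<dots> \<le> (\<Prod>j\<in>A. exp (real_of_int (bracket j) powr (- \<mu>) * Z))"
    proof (intro prod_mono conjI)
      fix j
      let ?w = "real_of_int (bracket j) powr (- \<mu>)"
      show "0 \<le> (\<Sum>m\<in>B. \<phi> j m)" by (intro sum_nonneg \<phi>0)
      have "0 \<in> B" by (auto simp: B_def R_def intro!: sum_nonneg)
      then have "(\<Sum>m\<in>B. \<phi> j m) = 1 + (\<Sum>m\<in>B - {0}. \<phi> j m)"
        by (subst sum.remove[of B 0]) (auto simp: B_def \<phi>_def)
      also have "(\<Sum>m\<in>B - {0}. \<phi> j m) = (\<Sum>m\<in>B - {0}. ?w * real_of_int (bracket m) powr (- \<mu>))"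
        using bracket_ge_1[of j]
        by (intro sum.cong refl) (auto simp: \<phi>_def bracket_def powr_mult [symmetric] max_def)
      also have "\<dots> \<le> ?w * Z"
        unfolding sum_distrib_left [symmetric] by (intro mult_left_mono Z) (auto simp: B_def)
      also have "1 + ?w * Z \<le> exp (?w * Z)" by simp
      finally show "(\<Sum>m\<in>B. \<phi> j m) \<le> exp (?w * Z)" by simp
    qed
    also have "\<dots> = exp ((\<Sum>j\<in>A. real_of_int (bracket j) powr (- \<mu>)) * Z)"
      using A by (simp add: exp_sum [symmetric] sum_distrib_right)
    also have "\<dots> \<le> exp (Z * Z)" using Z A by (simp add: mult_right_mono)
    finally show ?thesis .
  qed
  then show ?thesis by (intro nonneg_bdd_above_summable_on) (auto simp: bdd_above_def)
qed

text \<open>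
  For a given \<open>\<gamma>\<close> the rotations that violate the inequality for some \<open>k\<close> form a set of measure
  at most \<open>12 \<gamma> S\<close>, where \<open>S\<close> is the sum of \<open>freq_prod k powr (- \<mu>)\<close>. A rotation that admits
  no \<open>\<gamma>\<close> at all belongs to these sets for \<open>\<gamma> = 1, 1/2, 1/3, \<dots>\<close>, hence to a null set.
\<close>

lemma AE_nonresonant:
  fixes \<mu> u :: real
  assumes "1 < \<mu>" "J \<noteq> {}"
  shows "AE x in PiM J (\<lambda>_. uniform_measure lborel {u..u+1}).
    \<exists>\<gamma>>0. \<forall>k\<in>freqs \<eta> J. k \<noteq> (\<lambda>j. 0) \<longrightarrow> \<gamma> * freq_prod k powr (- \<mu>) \<le> cmod (1 - phase J k x)"
proof -
  define M where "M = PiM J (\<lambda>_. uniform_measure lborel {u..u+1})"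
  interpret prob_space M unfolding M_def by (intro prob_space_PiM prob_space_unit_uniform)
  define F where "F = freqs \<eta> J - {\<lambda>j. 0}"
  have F: "countable F" using countable_freqs[of \<eta> J] by (auto simp: F_def)
  have "infinite F"
  proof -
    obtain i where i: "i \<in> J" using assms(2) by auto
    define e where "e n = (\<lambda>j. if j = i then int n + 1 else 0)" for n
    have "inj e" by (auto simp: inj_on_def e_def fun_eq_iff split: if_splits)
    moreover have "range e \<subseteq> F"
    proof
      fix k assume "k \<in> range e"
      then obtain n where n: "k = e n" by auto
      have "supp k = {i}" by (auto simp: n e_def supp_def)
      then show "k \<in> F" using i by (auto simp: F_def freqs_iff supp_def)
    qed
    ultimately show ?thesis using infinite_super range_inj_infinite by blast
  qed
  then have bij: "bij_betw (from_nat_into F) UNIV F" using F by (rule bij_betw_from_nat_into[rotated])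
  define f where "f = from_nat_into F"
  have fF: "f n \<in> F" for n using bij by (auto simp: f_def bij_betw_def)
  define c where "c k = freq_prod k powr (- \<mu>)" for k
  have "c summable_on F" unfolding c_def F_def
    by (rule summable_on_subset_banach[OF freq_prod_powr_summable[OF assms(1), of \<eta> J]]) auto
  then have "(\<lambda>n. c (f n)) summable_on UNIV" using summable_on_reindex_bij_betw[OF bij, of c] by (simp add: f_def)
  then have sum: "summable (\<lambda>n. c (f n))" by (subst (asm) summable_on_UNIV_nonneg_real_iff) (auto simp: c_def)
  define S where "S = (\<Sum>n. c (f n))"
  have S: "0 \<le> S" unfolding S_def by (intro suminf_nonneg sum) (simp add: c_def)
  define B where "B g n = {x \<in> space M. cmod (1 - phase J (f n) x) < g * c (f n)}" for g n
  have Bm: "B g n \<in> sets M" "measure M (B g n) \<le> 12 * (g * c (f n))" if "0 \<le> g" for g n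
  proof -
    have k: "f n \<in> freqs \<eta> J" "f n \<noteq> (\<lambda>j. 0)" using fF[of n] by (auto simp: F_def)
    have nn: "0 \<le> g * c (f n)" using that by (simp add: c_def)
    show "B g n \<in> sets M" unfolding B_def M_def by (rule measure_near_resonance(1)[OF k nn])
    have "emeasure M (B g n) \<le> ennreal (12 * (g * c (f n)))"
      unfolding B_def M_def by (rule measure_near_resonance(2)[OF k nn])
    then show "measure M (B g n) \<le> 12 * (g * c (f n))" using nn by (simp add: emeasure_eq_measure)
  qed
  have U: "measure M (\<Union>n. B g n) \<le> 12 * g * S" if g: "0 \<le> g" for g
  proof -
    have s1: "summable (\<lambda>n. 12 * (g * c (f n)))" by (intro summable_mult sum)
    have s2: "summable (\<lambda>n. measure M (B g n))"
      by (rule summable_comparison_test[OF _ s1]) (use Bm(2)[OF g] in auto)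
    have "measure M (\<Union>n. B g n) \<le> (\<Sum>n. measure M (B g n))"
      using Bm(1)[OF g] s2 by (intro finite_measure_subadditive_countably) auto
    also have "\<dots> \<le> (\<Sum>n. 12 * (g * c (f n)))" by (intro suminf_le s1 s2 Bm(2) g)
    also have "\<dots> = 12 * g * S" using sum by (simp add: S_def suminf_mult summable_mult mult.assoc)
    finally show ?thesis .
  qed
  define N where "N = (\<Inter>i::nat. \<Union>n. B (1 / real (Suc i)) n)"
  have Nm: "N \<in> sets M" unfolding N_def by (intro sets.countable_INT' sets.countable_UN) (auto intro!: Bm(1))
  have "measure M N \<le> 12 * (1 / real (Suc i)) * S" for i
  proof -
    have "measure M N \<le> measure M (\<Union>n. B (1 / real (Suc i)) n)"
      by (intro finite_measure_mono sets.countable_UN) (auto simp: N_def intro!: Bm(1))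
    also have "\<dots> \<le> 12 * (1 / real (Suc i)) * S" by (rule U) auto
    finally show ?thesis .
  qed
  moreover have "(\<lambda>i. 12 * (1 / real (Suc i)) * S) \<longlonglongrightarrow> 12 * 0 * S"
    by (intro tendsto_intros LIMSEQ_Suc lim_inverse_n')
  ultimately have "measure M N \<le> 0" using LIMSEQ_le_const by fastforce
  then have "N \<in> null_sets M" using Nm by (simp add: null_sets_def emeasure_eq_measure measure_le_0_iff)
  moreover have "{x \<in> space M. \<not> (\<exists>\<gamma>>0. \<forall>k\<in>freqs \<eta> J. k \<noteq> (\<lambda>j. 0) \<longrightarrow> \<gamma> * freq_prod k powr (- \<mu>) \<le> cmod (1 - phase J k x))} \<subseteq> N"
  proof
    fix x assume x: "x \<in> {x \<in> space M. \<not> (\<exists>\<gamma>>0. \<forall>k\<in>freqs \<eta> J. k \<noteq> (\<lambda>j. 0) \<longrightarrow> \<gamma> * freq_prod k powr (- \<mu>) \<le> cmod (1 - phase J k x))}"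
    have "x \<in> (\<Union>n. B (1 / real (Suc i)) n)" for i
    proof -
      have "\<not> (0 < 1 / real (Suc i) \<and> (\<forall>k\<in>freqs \<eta> J. k \<noteq> (\<lambda>j. 0) \<longrightarrow>
          1 / real (Suc i) * freq_prod k powr (- \<mu>) \<le> cmod (1 - phase J k x)))"
        using x by blast
      moreover have "0 < 1 / real (Suc i)" by simp
      ultimately obtain k where k: "k \<in> F" "\<not> 1 / real (Suc i) * c k \<le> cmod (1 - phase J k x)"
        unfolding F_def c_def by blast
      then obtain n where "k = f n" using bij by (auto simp: f_def bij_betw_def)
      then have "x \<in> B (1 / real (Suc i)) n" using k(2) x unfolding B_def by force
      then show ?thesis by blast
    qed
    then show "x \<in> N" by (simp add: N_def)
  qed
  ultimately show ?thesis unfolding M_def [symmetric] by (rule AE_I')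
qed

section \<open>The error as a sum over frequencies\<close>

lemma exp_neg_2pi_i: "exp (- 2 * pi * \<i> * complex_of_real x) = cis (- (2 * pi * x))"
  by (simp add: cis_conv_exp mult_ac)

lemma norm_phase [simp]: "cmod (phase J k x) = 1"
  by (simp add: phase_def)

lemma phase_diff:
  assumes "k \<in> freqs \<eta> J" "s \<in> freqs \<eta> J"
  shows "phase J (\<lambda>j. k j - s j) x = phase J k x * cis (- (2 * pi * pairing J s x))"
  unfolding phase_def pairing_diff[OF assms] cis_mult by (simp add: algebra_simps)

lemma phase_rotate:
  assumes "k \<in> freqs \<eta> J"
  shows "phase J k (\<lambda>j. \<theta> j + real n * \<rho> j) = phase J k \<theta> * phase J k \<rho> ^ n"
  unfolding phase_def pairing_add[OF assms] pairing_scale[OF assms] Complex.DeMoivre cis_mult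
  by (rule arg_cong[of _ _ cis]) (simp add: algebra_simps)

lemma linf_le_ennreal_iff: "0 \<le> X \<Longrightarrow> linf v \<le> ennreal X \<longleftrightarrow> (\<forall>i. norm (v i) \<le> X)"
  by (auto simp: linf_def SUP_le_iff)

text \<open>
  What analyticity provides on the real torus: a Fourier expansion whose coefficients are
  dominated, uniformly in the component, by an exponentially weighted summable sequence.
\<close>

lemma torus_analytic_coefficients:
  assumes "torus_analytic \<eta> J K"
  obtains \<sigma> a where "0 < \<sigma>"
    "\<And>k. 0 \<le> a k"
    "\<And>k i. k \<in> freqs \<eta> J \<Longrightarrow> cmod (fourier J K k i) \<le> a k"
    "(\<lambda>k. a k * exp (2 * pi * \<sigma> * freq_norm \<eta> J k)) summable_on freqs \<eta> J"
    "\<And>\<theta> i. ((\<lambda>k. fourier J K k i * phase J k \<theta>) has_sum of_real (K \<theta> i)) (freqs \<eta> J)"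
proof -
  obtain \<sigma> and G :: "(int \<Rightarrow> complex) \<Rightarrow> 'a \<Rightarrow> complex" where \<sigma>: "0 < \<sigma>"
    and G: "\<And>x i. G (\<lambda>j. of_real (x j)) i = of_real (K x i)"
    and hs: "\<And>z i. z \<in> complex_strip \<eta> J \<sigma> \<Longrightarrow>
        ((\<lambda>k. fourier J K k i * exp (2 * pi * \<i> * pairing J k z)) has_sum G z i) (freqs \<eta> J)"
    and fin: "(\<Sum>\<^sub>\<infinity>k\<in>freqs \<eta> J. linf (fourier J K k) * ennreal (exp (2 * pi * \<sigma> * freq_norm \<eta> J k))) < \<infinity>"
    using assms unfolding torus_analytic_def by blast
  define e where "e k = exp (2 * pi * \<sigma> * freq_norm \<eta> J k)" for k
  define T where "T = (\<Sum>\<^sub>\<infinity>k\<in>freqs \<eta> J. linf (fourier J K k) * ennreal (e k))"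
  have Tfin: "T < \<infinity>" using fin by (simp add: T_def e_def)
  define a where "a k = enn2real (linf (fourier J K k))" for k
  have le_T: "(\<Sum>k\<in>B. linf (fourier J K k) * ennreal (e k)) \<le> T" if "finite B" "B \<subseteq> freqs \<eta> J" for B
    unfolding T_def infsum_finite[OF that(1), symmetric]
    using that by (intro infsum_mono_neutral nonneg_summable_on_complete) auto
  have a: "ennreal (a k) = linf (fourier J K k)" if k: "k \<in> freqs \<eta> J" for k
  proof -
    have "linf (fourier J K k) * ennreal (e k) \<le> T" using le_T[of "{k}"] k by simp
    then have "linf (fourier J K k) * ennreal (e k) < top" using Tfin by (simp add: order_le_less_trans)
    moreover have "ennreal (e k) \<noteq> 0" by (simp add: e_def)
    ultimately have "linf (fourier J K k) < top" by (auto simp: ennreal_mult_less_top less_top)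
    then show ?thesis by (simp add: a_def)
  qed
  have "(\<lambda>k. a k * e k) summable_on freqs \<eta> J"
  proof (rule nonneg_bdd_above_summable_on)
    have "sum (\<lambda>k. a k * e k) B \<le> enn2real T" if B: "finite B" "B \<subseteq> freqs \<eta> J" for B
    proof -
      have "ennreal (\<Sum>k\<in>B. a k * e k) = (\<Sum>k\<in>B. ennreal (a k * e k))"
        by (subst sum_ennreal) (auto simp: a_def e_def)
      also have "\<dots> = (\<Sum>k\<in>B. linf (fourier J K k) * ennreal (e k))"
      proof (intro sum.cong refl)
        fix k assume "k \<in> B"
        then have "ennreal (a k) = linf (fourier J K k)" using B by (intro a) auto
        moreover have "ennreal (a k * e k) = ennreal (a k) * ennreal (e k)"
          by (rule ennreal_mult) (auto simp: a_def e_def)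
        ultimately show "ennreal (a k * e k) = linf (fourier J K k) * ennreal (e k)" by simp
      qed
      also have "\<dots> \<le> T" by (rule le_T[OF B])
      also have "T = ennreal (enn2real T)" using Tfin by simp
      finally show ?thesis by simp
    qed
    then show "bdd_above (sum (\<lambda>k. a k * e k) ` {F. F \<subseteq> freqs \<eta> J \<and> finite F})"
      by (auto simp: bdd_above_def)
  qed (auto simp: a_def e_def)
  moreover have "cmod (fourier J K k i) \<le> a k" if "k \<in> freqs \<eta> J" for k i
    using a[OF that] linf_le_ennreal_iff[of "a k" "fourier J K k"] by (simp add: a_def)
  moreover have "((\<lambda>k. fourier J K k i * phase J k \<theta>) has_sum of_real (K \<theta> i)) (freqs \<eta> J)" for \<theta> i
  proof -
    have "(\<lambda>j. complex_of_real (\<theta> j)) \<in> complex_strip \<eta> J \<sigma>"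
      using \<sigma> bracket_ge_1 order_trans[OF zero_le_one bracket_ge_1] by (auto simp: complex_strip_def)
    note h = hs[OF this, of i, unfolded G]
    show ?thesis
      by (rule has_sum_cong[THEN iffD1, OF _ h]) (simp add: pairing_of_real phase_def cis_conv_exp mult_ac)
  qed
  ultimately show ?thesis using that[of \<sigma> a] \<sigma> by (simp add: a_def e_def)
qed

lemma has_sum_sum_finite:
  fixes f :: "'a \<Rightarrow> 'b \<Rightarrow> complex"
  assumes "finite I" "\<And>n. n \<in> I \<Longrightarrow> (f n has_sum S n) A"
  shows "((\<lambda>k. \<Sum>n\<in>I. f n k) has_sum (\<Sum>n\<in>I. S n)) A"
  using assms by (induction I rule: finite_induct) (auto intro!: has_sum_add)

text \<open>
  Inserting the Fourier expansion into the weighted sum turns the error into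
  \<open>\<Sum>k\<noteq>s. K k * phase (k - s) \<theta> * W (phase (k - s) \<rho>)\<close>, where \<open>K k\<close> denotes the
  coefficients and \<open>W\<close> the weighted average of a character; the term \<open>k = s\<close> cancels
  exactly because the average of the constant character is 1. It therefore suffices to
  control, for each \<open>k\<close> separately, the product of the average and the exponential decay of the
  coefficient.
\<close>

lemma fourier_error_le:
  assumes pq: "0 < p" "0 < q" and N: "2 \<le> N" and s: "s \<in> freqs \<eta> J" and X: "0 \<le> X"
    and a: "\<And>k. 0 \<le> a k" "\<And>k i. k \<in> freqs \<eta> J \<Longrightarrow> cmod (fourier J K k i) \<le> a k"
    and sm: "(\<lambda>k. a k * exp (2 * pi * \<sigma> * freq_norm \<eta> J k)) summable_on freqs \<eta> J"
    and K: "\<And>\<theta> i. ((\<lambda>k. fourier J K k i * phase J k \<theta>) has_sum of_real (K \<theta> i)) (freqs \<eta> J)"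
    and F: "\<And>\<theta>. F (K \<theta>) = K (\<lambda>j. \<theta> j + \<rho> j)"
    and W: "\<And>k. k \<in> freqs \<eta> J \<Longrightarrow> k \<noteq> s \<Longrightarrow>
      cmod (weighted_avg p q N (phase J (\<lambda>j. k j - s j) \<rho>)) * exp (- 2 * pi * \<sigma> * freq_norm \<eta> J k) \<le> X"
  shows "fourier_error p q J K F \<rho> N s \<theta>
    \<le> ennreal ((\<Sum>\<^sub>\<infinity>k\<in>freqs \<eta> J. a k * exp (2 * pi * \<sigma> * freq_norm \<eta> J k)) * X)"
proof -
  define M where "M = (\<Sum>\<^sub>\<infinity>k\<in>freqs \<eta> J. a k * exp (2 * pi * \<sigma> * freq_norm \<eta> J k))"
  have M0: "0 \<le> M" unfolding M_def using a(1) by (intro infsum_nonneg) auto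
  have iter: "(F ^^ n) (K \<theta>) = K (\<lambda>j. \<theta> j + real n * \<rho> j)" for n
    by (induction n) (auto simp: F algebra_simps)
  define A where "A = complex_of_real (1 / weight_total p q N)"
  define w where "w n = complex_of_real (weight p q (real n / real N))" for n
  define E where "E = cis (- (2 * pi * pairing J s \<theta>))"
  define z where "z = cis (- (2 * pi * pairing J s \<rho>))"
  have zn: "cis (- (2 * pi * (real n * pairing J s \<rho>))) = z ^ n" for n
    unfolding z_def Complex.DeMoivre by (rule arg_cong[of _ _ cis]) simp
  have "cmod (fourier J K s i - E * A * (\<Sum>n = 1..N - 1. w n * of_real (K (\<lambda>j. \<theta> j + real n * \<rho> j) i) * z ^ n)) \<le> M * X" for i
  proof -
    let ?c = "\<lambda>k. fourier J K k i"
    let ?Kn = "\<lambda>n. K (\<lambda>j. \<theta> j + real n * \<rho> j) i"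
    define t where "t k = (if k = s then ?c s else 0) - ?c k * (E * phase J k \<theta>) * weighted_avg p q N (phase J (\<lambda>j. k j - s j) \<rho>)" for k
    have "((\<lambda>k. \<Sum>n = 1..N - 1. (w n * z ^ n) * (?c k * phase J k (\<lambda>j. \<theta> j + real n * \<rho> j))) has_sum
       (\<Sum>n = 1..N - 1. (w n * z ^ n) * of_real (?Kn n))) (freqs \<eta> J)"
      by (intro has_sum_sum_finite has_sum_cmult_right K) auto
    then have "((\<lambda>k. (E * A) * (\<Sum>n = 1..N - 1. (w n * z ^ n) * (?c k * phase J k (\<lambda>j. \<theta> j + real n * \<rho> j)))) has_sum
       ((E * A) * (\<Sum>n = 1..N - 1. (w n * z ^ n) * of_real (?Kn n)))) (freqs \<eta> J)"
      by (rule has_sum_cmult_right)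
    moreover have "(E * A) * (\<Sum>n = 1..N - 1. (w n * z ^ n) * (?c k * phase J k (\<lambda>j. \<theta> j + real n * \<rho> j)))
       = ?c k * (E * phase J k \<theta>) * weighted_avg p q N (phase J (\<lambda>j. k j - s j) \<rho>)" if k: "k \<in> freqs \<eta> J" for k
      unfolding weighted_avg_def phase_rotate[OF k] phase_diff[OF k s] z_def[symmetric] A_def[symmetric] w_def[symmetric]
      by (simp add: sum_distrib_left power_mult_distrib mult_ac)
    ultimately have h1: "((\<lambda>k. ?c k * (E * phase J k \<theta>) * weighted_avg p q N (phase J (\<lambda>j. k j - s j) \<rho>)) has_sum
       ((E * A) * (\<Sum>n = 1..N - 1. (w n * z ^ n) * of_real (?Kn n)))) (freqs \<eta> J)"
      by (subst has_sum_cong[of "freqs \<eta> J", symmetric]) auto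
    have h2: "((\<lambda>k. if k = s then ?c s else 0) has_sum ?c s) (freqs \<eta> J)"
      using s by (intro has_sum_finite_neutralI[of "{s}"]) auto
    have h: "(t has_sum (?c s - (E * A) * (\<Sum>n = 1..N - 1. (w n * z ^ n) * of_real (?Kn n)))) (freqs \<eta> J)"
      using has_sum_add[OF h2 has_sum_uminusI[OF h1]] unfolding t_def by simp
    have tb: "cmod (t k) \<le> (a k * exp (2 * pi * \<sigma> * freq_norm \<eta> J k)) * X" if k: "k \<in> freqs \<eta> J" for k
    proof (cases "k = s")
      case True
      have "phase J (\<lambda>j. s j - s j) \<rho> = 1"
        unfolding phase_diff[OF s s] by (simp add: phase_def cis_mult)
      moreover have "E * phase J s \<theta> = 1" by (simp add: E_def phase_def cis_mult)
      ultimately have "t k = 0" using weighted_avg_1[OF pq N] by (simp add: t_def True)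
      then show ?thesis using a(1) X by simp
    next
      case False
      define g where "g = exp (2 * pi * \<sigma> * freq_norm \<eta> J k)"
      have g: "0 < g" "exp (- 2 * pi * \<sigma> * freq_norm \<eta> J k) = 1 / g" by (auto simp: g_def exp_minus inverse_eq_divide)
      have "cmod (t k) = cmod (?c k) * cmod (weighted_avg p q N (phase J (\<lambda>j. k j - s j) \<rho>))"
        using False by (simp add: t_def norm_mult E_def)
      also have "\<dots> \<le> a k * (g * X)"
      proof (intro mult_mono a(1) a(2)[OF k])
        show "cmod (weighted_avg p q N (phase J (\<lambda>j. k j - s j) \<rho>)) \<le> g * X"
          using W[OF k False] g(1) unfolding g(2) by (simp add: pos_divide_le_eq mult.commute)
      qed auto
      finally show ?thesis by (simp add: g_def mult_ac)
    qed
    have "cmod (?c s - (E * A) * (\<Sum>n = 1..N - 1. (w n * z ^ n) * of_real (?Kn n))) \<le> M * X"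
      unfolding M_def
      by (rule norm_infsum_le[OF h has_sum_cmult_left[OF has_sum_infsum[OF sm]] tb])
    then show ?thesis by (simp add: mult_ac)
  qed
  then have "fourier_error p q J K F \<rho> N s \<theta> \<le> ennreal (M * X)"
    unfolding fourier_error_def iter exp_neg_2pi_i zn E_def A_def w_def using M0 X
    by (subst linf_le_ennreal_iff) simp_all
  then show ?thesis by (simp add: M_def)
qed

section \<open>From decay of averages to error rates\<close>

text \<open>
  Frequencies are split at \<open>freq_norm k = \<phi> N / (2 \<pi> \<sigma>)\<close>. Beyond the threshold the
  coefficients themselves are below \<open>exp (- \<phi> N)\<close>. Below it, \<open>k - s\<close> has norm \<open>O(\<phi> N)\<close> when
  \<open>s\<close> has, so that the decay of the averages applies uniformly in \<open>s\<close>.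
\<close>

lemma error_rate:
  fixes \<phi> :: "nat \<Rightarrow> real" and K :: "(int \<Rightarrow> real) \<Rightarrow> 'i \<Rightarrow> real"
  assumes pq: "0 < p" "0 < q" and K: "torus_analytic \<eta> J K"
    and F: "\<And>\<theta>. F (K \<theta>) = K (\<lambda>j. \<theta> j + \<rho> j)"
    and \<phi>: "\<And>N. 0 \<le> \<phi> N"
    and R: "\<And>L. 0 < L \<Longrightarrow> \<forall>\<^sub>F N in sequentially. \<forall>k\<in>freqs \<eta> J. k \<noteq> (\<lambda>j. 0) \<longrightarrow>
        freq_norm \<eta> J k \<le> L * \<phi> N \<longrightarrow> cmod (weighted_avg p q N (phase J k \<rho>)) \<le> exp (- \<phi> N)"
    and S: "\<And>N. 0 \<le> S N" "S \<in> o(\<phi>)"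
  shows "\<exists>C::real. \<forall>N\<ge>2. \<forall>s\<in>freqs \<eta> J. freq_norm \<eta> J s \<le> S N \<longrightarrow>
    (\<forall>\<theta>. fourier_error p q J K F \<rho> N s \<theta> \<le> ennreal (C * exp (- \<phi> N)))"
proof -
  obtain \<sigma> a where \<sigma>: "0 < \<sigma>" and a: "\<And>k. 0 \<le> a k"
    "\<And>k i. k \<in> freqs \<eta> J \<Longrightarrow> cmod (fourier J K k i) \<le> a k"
    and sm: "(\<lambda>k. a k * exp (2 * pi * \<sigma> * freq_norm \<eta> J k)) summable_on freqs \<eta> J"
    and hs: "\<And>\<theta> i. ((\<lambda>k. fourier J K k i * phase J k \<theta>) has_sum of_real (K \<theta> i)) (freqs \<eta> J)"
    using torus_analytic_coefficients[OF K] by blast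
  define M where "M = (\<Sum>\<^sub>\<infinity>k\<in>freqs \<eta> J. a k * exp (2 * pi * \<sigma> * freq_norm \<eta> J k))"
  have M0: "0 \<le> M" unfolding M_def using a(1) by (intro infsum_nonneg) auto
  define L where "L = 1 / (2 * pi * \<sigma>)"
  have L: "0 < L" using \<sigma> by (simp add: L_def)
  have "\<forall>\<^sub>F N in sequentially. norm (S N) \<le> 1 * norm (\<phi> N)"
    using landau_o.smallD[OF S(2), of 1] by simp
  moreover have "\<forall>\<^sub>F N in sequentially. \<forall>k\<in>freqs \<eta> J. k \<noteq> (\<lambda>j. 0) \<longrightarrow>
        freq_norm \<eta> J k \<le> (L + 1) * \<phi> N \<longrightarrow> cmod (weighted_avg p q N (phase J k \<rho>)) \<le> exp (- \<phi> N)"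
    using R[of "L + 1"] L by simp
  ultimately have "\<forall>\<^sub>F N in sequentially. S N \<le> \<phi> N \<and> (\<forall>k\<in>freqs \<eta> J. k \<noteq> (\<lambda>j. 0) \<longrightarrow>
        freq_norm \<eta> J k \<le> (L + 1) * \<phi> N \<longrightarrow> cmod (weighted_avg p q N (phase J k \<rho>)) \<le> exp (- \<phi> N))"
    by eventually_elim (use S(1) \<phi> in auto)
  then obtain N1 where N1: "\<And>N. N1 \<le> N \<Longrightarrow> S N \<le> \<phi> N"
    "\<And>N k. N1 \<le> N \<Longrightarrow> k \<in> freqs \<eta> J \<Longrightarrow> k \<noteq> (\<lambda>j. 0) \<Longrightarrow> freq_norm \<eta> J k \<le> (L + 1) * \<phi> N \<Longrightarrow>
       cmod (weighted_avg p q N (phase J k \<rho>)) \<le> exp (- \<phi> N)"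
    unfolding eventually_sequentially by blast
  \<comment> \<open>\<open>exp B\<close> absorbs the finitely many \<open>N\<close> to which the asymptotic estimates do not apply\<close>
  define B where "B = (\<Sum>N<N1. \<phi> N)"
  have B: "0 \<le> B" unfolding B_def by (intro sum_nonneg \<phi>)
  have "fourier_error p q J K F \<rho> N s \<theta> \<le> ennreal ((M * exp B) * exp (- \<phi> N))"
    if N: "2 \<le> N" and s: "s \<in> freqs \<eta> J" "freq_norm \<eta> J s \<le> S N" for N s \<theta>
  proof (cases "N1 \<le> N")
    case False
    have "fourier_error p q J K F \<rho> N s \<theta> \<le> ennreal (M * 1)"
      unfolding M_def
    proof (rule fourier_error_le[OF pq N s(1) _ a sm hs F])
      fix k assume "k \<in> freqs \<eta> J"
      then have "0 \<le> freq_norm \<eta> J k" by (rule freq_norm_nonneg)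
      then show "cmod (weighted_avg p q N (phase J (\<lambda>j. k j - s j) \<rho>)) * exp (- 2 * pi * \<sigma> * freq_norm \<eta> J k) \<le> 1"
        using weighted_avg_le_1[OF pq N norm_phase] \<sigma> by (intro mult_le_one) auto
    qed auto
    also have "\<dots> \<le> ennreal ((M * exp B) * exp (- \<phi> N))"
    proof (rule ennreal_leI)
      have "\<phi> N \<le> B" unfolding B_def using False \<phi> by (intro member_le_sum) auto
      then have "1 \<le> exp B * exp (- \<phi> N)" by (simp add: exp_add [symmetric])
      then show "M * 1 \<le> (M * exp B) * exp (- \<phi> N)" using mult_left_mono[OF _ M0] by (simp only: mult.assoc)
    qed
    finally show ?thesis .
  next
    case True
    have "fourier_error p q J K F \<rho> N s \<theta> \<le> ennreal (M * exp (- \<phi> N))"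
      unfolding M_def
    proof (rule fourier_error_le[OF pq N s(1) _ a sm hs F])
      fix k assume k: "k \<in> freqs \<eta> J" "k \<noteq> s"
      note nn = freq_norm_nonneg[OF k(1)]
      show "cmod (weighted_avg p q N (phase J (\<lambda>j. k j - s j) \<rho>)) * exp (- 2 * pi * \<sigma> * freq_norm \<eta> J k) \<le> exp (- \<phi> N)"
      proof (cases "L * \<phi> N \<le> freq_norm \<eta> J k")
        case True
        then have "\<phi> N \<le> 2 * pi * \<sigma> * freq_norm \<eta> J k"
          using \<sigma> by (simp add: L_def pos_divide_le_eq mult_ac)
        then have "cmod (weighted_avg p q N (phase J (\<lambda>j. k j - s j) \<rho>)) * exp (- 2 * pi * \<sigma> * freq_norm \<eta> J k) \<le> 1 * exp (- \<phi> N)"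
          using weighted_avg_le_1[OF pq N norm_phase] by (intro mult_mono) auto
        then show ?thesis by simp
      next
        case False
        have "freq_norm \<eta> J (\<lambda>j. k j - s j) \<le> (L + 1) * \<phi> N"
          using freq_norm_diff[OF k(1) s(1)] s(2) N1(1)[OF \<open>N1 \<le> N\<close>] False by (simp add: distrib_right)
        moreover have "(\<lambda>j. k j - s j) \<noteq> (\<lambda>j. 0)" using k(2) by (auto simp: fun_eq_iff)
        ultimately have "cmod (weighted_avg p q N (phase J (\<lambda>j. k j - s j) \<rho>)) \<le> exp (- \<phi> N)"
          using N1(2)[OF \<open>N1 \<le> N\<close> freqs_diff[OF k(1) s(1)]] by blast
        then have "cmod (weighted_avg p q N (phase J (\<lambda>j. k j - s j) \<rho>)) * exp (- 2 * pi * \<sigma> * freq_norm \<eta> J k) \<le> exp (- \<phi> N) * 1"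
          using \<sigma> nn by (intro mult_mono) auto
        then show ?thesis by simp
      qed
    qed auto
    also have "\<dots> \<le> ennreal ((M * exp B) * exp (- \<phi> N))"
      using B M0 by (intro ennreal_leI mult_right_mono) (auto simp: mult_le_cancel_left1)
    finally show ?thesis .
  qed
  then show ?thesis by blast
qed

text \<open>
  The exponents \<open>1 + 1/(n+1)\<close> decrease to 1. In dimension \<open>m\<close> they lead to Diophantine
  exponents arbitrarily close to \<open>m\<close>, as the sharp range of rates demands. Countably many
  exponents keep the condition almost sure.
\<close>

definition nonresonant :: "nat \<Rightarrow> int set \<Rightarrow> (int \<Rightarrow> real) \<Rightarrow> bool" where
  "nonresonant \<eta> J \<rho> \<longleftrightarrow> (\<forall>n::nat. \<exists>\<gamma>>0. \<forall>k\<in>freqs \<eta> J. k \<noteq> (\<lambda>j. 0) \<longrightarrow>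
     \<gamma> * freq_prod k powr (- (1 + 1 / real (Suc n))) \<le> cmod (1 - phase J k \<rho>))"

lemma nonresonantE:
  assumes "nonresonant \<eta> J \<rho>"
  obtains \<gamma> where "0 < \<gamma>"
    "\<And>k P. k \<in> freqs \<eta> J \<Longrightarrow> k \<noteq> (\<lambda>j. 0) \<Longrightarrow> freq_prod k \<le> P \<Longrightarrow>
       \<gamma> * P powr (- (1 + 1 / real (Suc n))) \<le> cmod (1 - phase J k \<rho>)"
proof -
  obtain \<gamma> where \<gamma>: "0 < \<gamma>" "\<And>k. k \<in> freqs \<eta> J \<Longrightarrow> k \<noteq> (\<lambda>j. 0) \<Longrightarrow>
     \<gamma> * freq_prod k powr (- (1 + 1 / real (Suc n))) \<le> cmod (1 - phase J k \<rho>)"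
    using assms unfolding nonresonant_def by blast
  have "\<gamma> * P powr (- (1 + 1 / real (Suc n))) \<le> cmod (1 - phase J k \<rho>)"
    if "k \<in> freqs \<eta> J" "k \<noteq> (\<lambda>j. 0)" "freq_prod k \<le> P" for k P
  proof -
    have "P powr (- (1 + 1 / real (Suc n))) \<le> freq_prod k powr (- (1 + 1 / real (Suc n)))"
    proof (rule powr_mono2')
      have "0 \<le> 1 / real (Suc n)" by simp
      then show "- (1 + 1 / real (Suc n)) \<le> 0" by linarith
    qed (use that(3) freq_prod_ge_1[of k] in auto)
    then show ?thesis using \<gamma>(2)[OF that(1,2)] mult_left_mono[of _ _ \<gamma>] \<gamma>(1) by (meson less_imp_le order_trans)
  qed
  then show ?thesis using that \<gamma>(1) by blast
qed

lemma freq_prod_le_power: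
  assumes "\<And>j. j \<in> supp k \<Longrightarrow> real_of_int (bracket j * \<bar>k j\<bar>) \<le> B" "1 \<le> B"
  shows "freq_prod k \<le> B ^ card (supp k)"
  unfolding freq_prod_def
  using assms order_trans[OF zero_le_one freq_prod_factor_ge_1]
  by (intro prod_le_power) (auto simp del: of_int_mult of_int_abs)

lemma finite_freq_prod_le:
  assumes k: "k \<in> freqs \<eta> {1..int m}" "k \<noteq> (\<lambda>j. 0)" and \<Lambda>: "freq_norm \<eta> {1..int m} k \<le> \<Lambda>"
  shows "freq_prod k \<le> (real m * \<Lambda>) ^ m"
proof -
  have sup: "finite (supp k)" "supp k \<subseteq> {1..int m}" using k by (auto simp: freqs_iff)
  obtain i where "i \<in> supp k" using k(2) by (auto simp: supp_def)
  then have "1 \<le> m" using sup by auto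
  have \<Lambda>1: "1 \<le> \<Lambda>" using freq_norm_ge_1[OF k] \<Lambda> by simp
  have m\<Lambda>: "1 \<le> real m * \<Lambda>" using mult_mono[of 1 "real m" 1 \<Lambda>] \<Lambda>1 \<open>1 \<le> m\<close> by simp
  have "freq_prod k \<le> (real m * \<Lambda>) ^ card (supp k)"
  proof (rule freq_prod_le_power)
    fix j assume j: "j \<in> supp k"
    have "\<bar>real_of_int (k j)\<bar> \<le> \<Lambda>" using term_le_freq_norm[OF k(1) j] \<Lambda> by (simp add: site_weight_def)
    moreover have "real_of_int (bracket j) \<le> real m" using j sup by (auto simp: bracket_def)
    ultimately show "real_of_int (bracket j * \<bar>k j\<bar>) \<le> real m * \<Lambda>" by (auto intro!: mult_mono)
  qed (rule m\<Lambda>)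
  also have "\<dots> \<le> (real m * \<Lambda>) ^ m"
  proof (rule power_increasing)
    show "card (supp k) \<le> m" using card_mono[OF _ sup(2)] by simp
  qed (rule m\<Lambda>)
  finally show ?thesis .
qed

text \<open>
  A frequency of norm \<open>\<Lambda>\<close> has few nonzero coordinates: at most \<open>2R + 1\<close> of them satisfy
  \<open>\<langle>j\<rangle> \<le> R\<close>, and each further one contributes at least \<open>R^\<eta>\<close> to the norm, so there are at most
  \<open>\<Lambda> / R^\<eta>\<close> of those. The two counts balance at \<open>R = \<Lambda>^{1/(1+\<eta>)}\<close>, the source of the
  exponent \<open>1 + \<eta>\<close>.
\<close>

lemma card_supp_le:
  assumes k: "k \<in> freqs \<eta> J" "k \<noteq> (\<lambda>j. 0)" and J: "infinite J" and \<Lambda>: "freq_norm \<eta> J k \<le> \<Lambda>"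
  shows "real (card (supp k)) \<le> 4 * \<Lambda> powr (1 / (1 + real \<eta>))"
proof -
  have sup: "finite (supp k)" "supp k \<subseteq> J" using k by (auto simp: freqs_iff)
  have \<Lambda>1: "1 \<le> \<Lambda>" using freq_norm_ge_1[OF k] \<Lambda> by simp
  define R where "R = \<Lambda> powr (1 / (1 + real \<eta>))"
  have R1: "1 \<le> R" unfolding R_def using \<Lambda>1 by (intro ge_one_powr_ge_zero) auto
  have R\<Lambda>: "R ^ \<eta> * R = \<Lambda>"
  proof -
    have "R ^ \<eta> * R = R powr (1 + real \<eta>)" using R1 by (simp add: powr_add powr_realpow)
    also have "\<dots> = \<Lambda>" using \<Lambda>1 by (simp add: R_def powr_powr)
    finally show ?thesis .
  qed
  define A where "A = {j \<in> supp k. real_of_int (bracket j) \<le> R}"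
  define B where "B = {j \<in> supp k. R < real_of_int (bracket j)}"
  have "supp k = A \<union> B" "A \<inter> B = {}" by (auto simp: A_def B_def)
  then have card: "card (supp k) = card A + card B" using sup(1) card_Un_disjoint finite_Un by metis
  have "A \<subseteq> {- \<lfloor>R\<rfloor>..\<lfloor>R\<rfloor>}"
  proof
    fix j assume "j \<in> A"
    then have "bracket j \<le> \<lfloor>R\<rfloor>" by (simp add: A_def le_floor_iff)
    then show "j \<in> {- \<lfloor>R\<rfloor>..\<lfloor>R\<rfloor>}" by (auto simp: bracket_def)
  qed
  then have "card A \<le> nat (2 * \<lfloor>R\<rfloor> + 1)" using card_mono[of "{- \<lfloor>R\<rfloor>..\<lfloor>R\<rfloor>}" A] by simp
  moreover have "real (nat (2 * \<lfloor>R\<rfloor> + 1)) \<le> 2 * R + 1" using R1 by linarith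
  ultimately have cA: "real (card A) \<le> 2 * R + 1" by linarith
  have "real (card B) * R ^ \<eta> = (\<Sum>j\<in>B. R ^ \<eta>)" by simp
  also have "\<dots> \<le> (\<Sum>j\<in>B. site_weight \<eta> J j * \<bar>real_of_int (k j)\<bar>)"
  proof (intro sum_mono)
    fix j assume j: "j \<in> B"
    have "R ^ \<eta> * 1 \<le> real_of_int (bracket j) ^ \<eta> * \<bar>real_of_int (k j)\<bar>"
      using j R1 by (intro mult_mono power_mono) (auto simp: B_def supp_def)
    then show "R ^ \<eta> \<le> site_weight \<eta> J j * \<bar>real_of_int (k j)\<bar>" using J by (simp add: site_weight_def)
  qed
  also have "\<dots> \<le> (\<Sum>j\<in>supp k. site_weight \<eta> J j * \<bar>real_of_int (k j)\<bar>)"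
    using sup(1) site_weight_nonneg by (intro sum_mono2) (auto simp: B_def)
  also have "\<dots> \<le> \<Lambda>" using \<Lambda> freq_norm_eq_sum[OF sup(1) order_refl sup(2)] by simp
  finally have "real (card B) * R ^ \<eta> \<le> R * R ^ \<eta>" using R\<Lambda> by (simp add: mult.commute)
  then have cB: "real (card B) \<le> R" using R1 by (simp add: mult_le_cancel_right)
  have "real (card (supp k)) \<le> 4 * R" using card cA cB R1 by simp
  then show ?thesis by (simp add: R_def)
qed

lemma infinite_freq_prod_le:
  assumes k: "k \<in> freqs \<eta> J" "k \<noteq> (\<lambda>j. 0)" and J: "infinite J" and \<eta>: "1 \<le> \<eta>"
    and \<Lambda>: "freq_norm \<eta> J k \<le> \<Lambda>"
  shows "freq_prod k \<le> \<Lambda> powr (4 * \<Lambda> powr (1 / (1 + real \<eta>)))"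
proof -
  have \<Lambda>1: "1 \<le> \<Lambda>" using freq_norm_ge_1[OF k] \<Lambda> by simp
  have "freq_prod k \<le> \<Lambda> ^ card (supp k)"
  proof (rule freq_prod_le_power)
    fix j assume j: "j \<in> supp k"
    have "real_of_int (bracket j) ^ 1 \<le> real_of_int (bracket j) ^ \<eta>"
      using bracket_ge_1[of j] \<eta> by (intro power_increasing) auto
    then have "real_of_int (bracket j * \<bar>k j\<bar>) \<le> site_weight \<eta> J j * \<bar>real_of_int (k j)\<bar>"
      using J by (auto simp: site_weight_def intro!: mult_right_mono)
    then show "real_of_int (bracket j * \<bar>k j\<bar>) \<le> \<Lambda>" using term_le_freq_norm[OF k(1) j] \<Lambda> by linarith
  qed (rule \<Lambda>1)
  also have "\<dots> = \<Lambda> powr real (card (supp k))" using \<Lambda>1 by (simp add: powr_realpow)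
  also have "\<dots> \<le> \<Lambda> powr (4 * \<Lambda> powr (1 / (1 + real \<eta>)))"
    using \<Lambda>1 card_supp_le[OF k J \<Lambda>] by (intro powr_mono) auto
  finally show ?thesis .
qed

section \<open>Decay of averages at nonresonant rotations\<close>

lemma AE_rotation_nonresonant:
  assumes "torus_index d J"
  shows "AE \<rho> in rotation_measure J. nonresonant \<eta> J \<rho>"
proof -
  have "J \<noteq> {}" using assms by (auto simp: torus_index_def split: enat.splits)
  then have "AE x in PiM J (\<lambda>_. uniform_measure lborel {u..u+1}).
    \<exists>\<gamma>>0. \<forall>k\<in>freqs \<eta> J. k \<noteq> (\<lambda>j. 0) \<longrightarrow>
      \<gamma> * freq_prod k powr (- (1 + 1 / real (Suc n))) \<le> cmod (1 - phase J k x)" for u n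
    by (intro AE_nonresonant) auto
  then have "AE x in PiM J (\<lambda>_. uniform_measure lborel {u..u+1}). nonresonant \<eta> J x" for u
    unfolding nonresonant_def by (simp add: AE_all_countable)
  moreover have "\<exists>u. rotation_measure J = PiM J (\<lambda>_. uniform_measure lborel {u..u+1})"
    by (rule exI[of _ "if finite J then 0 else 1"]) (simp add: rotation_measure_def)
  ultimately show ?thesis by metis
qed

text \<open>
  Of two stretched exponentials the one with the larger exponent wins, whatever the constants
  and polynomial factors.
\<close>

lemma eventually_stretched_exp_le:
  fixes \<zeta> \<kappa> c C :: real
  assumes "0 < \<zeta>" "\<zeta> < \<kappa>" "0 < c" "0 < C"
  shows "\<forall>\<^sub>F x in at_top. C * x * exp (- c * x powr \<kappa>) \<le> exp (- (x powr \<zeta>))"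
  using assms by real_asymp

text \<open>
  For frequencies of norm \<open>O(N^\<zeta>)\<close> the small divisor is at least a multiple of
  \<open>N^{-\<zeta> m \<mu>}\<close>. The average is then at most
  \<open>C N exp (- c N^{(1 - \<zeta> m \<mu>) / (1 + 1/r)})\<close>, and the exponent exceeds \<open>\<zeta>\<close> exactly when
  \<open>\<zeta> (m \<mu> + 1 + 1/r) < 1\<close>.
\<close>

lemma finite_dim_decay:
  fixes m :: nat and \<zeta> L :: real
  assumes pq: "0 < p" "0 < q" and m: "1 \<le> m"
    and \<zeta>: "0 < \<zeta>" "\<zeta> < inverse (real m + 1 + 1 / min p q)"
    and nr: "nonresonant \<eta> {1..int m} \<rho>" and L: "0 < L"
  shows "\<forall>\<^sub>F N in sequentially. \<forall>k\<in>freqs \<eta> {1..int m}. k \<noteq> (\<lambda>j. 0) \<longrightarrow>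
    freq_norm \<eta> {1..int m} k \<le> L * real N powr \<zeta> \<longrightarrow>
    cmod (weighted_avg p q N (phase {1..int m} k \<rho>)) \<le> exp (- (real N powr \<zeta>))"
proof -
  let ?J = "{1..int m}"
  define A where "A = 1 + 1 / min p q"
  have A: "1 < A" using pq by (simp add: A_def)
  define \<beta> where "\<beta> = 1 / A"
  have \<beta>: "0 < \<beta>" using A by (simp add: \<beta>_def)
  have gap: "\<zeta> * (real m + A) < 1"
  proof -
    have "\<zeta> < inverse (real m + A)" using \<zeta>(2) by (simp add: A_def add.assoc)
    then show ?thesis using A by (simp add: inverse_eq_divide pos_less_divide_eq)
  qed
  \<comment> \<open>\<open>n\<close> is so large that \<open>\<mu> = 1 + 1/(n+1)\<close> keeps \<open>\<zeta> (m \<mu> + A)\<close> below 1\<close>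
  obtain n where n: "\<zeta> * real m / (1 - \<zeta> * (real m + A)) < real (Suc n)"
    using reals_Archimedean2 by (metis less_trans of_nat_less_iff lessI)
  define \<mu> where "\<mu> = 1 + 1 / real (Suc n)"
  have "\<zeta> * real m / real (Suc n) < 1 - \<zeta> * (real m + A)"
    using n gap by (simp add: field_simps del: of_nat_Suc)
  then have key: "\<zeta> * (real m * \<mu> + A) < 1" by (simp add: \<mu>_def algebra_simps del: of_nat_Suc)
  define \<kappa> where "\<kappa> = (1 - \<zeta> * (real m * \<mu>)) * \<beta>"
  have \<kappa>: "\<zeta> < \<kappa>" using key A by (simp add: \<kappa>_def \<beta>_def field_simps)
  obtain \<gamma> where \<gamma>: "0 < \<gamma>" "\<And>k P. k \<in> freqs \<eta> ?J \<Longrightarrow> k \<noteq> (\<lambda>j. 0) \<Longrightarrow> freq_prod k \<le> P \<Longrightarrow>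
       \<gamma> * P powr (- \<mu>) \<le> cmod (1 - phase ?J k \<rho>)"
    using nonresonantE[OF nr, of n] unfolding \<mu>_def by metis
  obtain c C where cC: "0 < c" "0 < C" "\<And>N z. 2 \<le> N \<Longrightarrow> cmod z = 1 \<Longrightarrow>
     cmod (weighted_avg p q N z) \<le> C * real N * exp (- c * (real N * cmod (1 - z)) powr \<beta>)"
    using weighted_avg_decay[OF pq] unfolding \<beta>_def A_def by metis
  define g where "g = \<gamma> * (real m * L) powr (- (real m * \<mu>))"
  have g: "0 < g" using \<gamma>(1) m L by (simp add: g_def)
  have "\<forall>\<^sub>F x in at_top. C * x * exp (- (c * g powr \<beta>) * x powr \<kappa>) \<le> exp (- (x powr \<zeta>))"
    using \<zeta>(1) \<kappa> cC g by (intro eventually_stretched_exp_le) auto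
  then have "\<forall>\<^sub>F N in sequentially. C * real N * exp (- (c * g powr \<beta>) * real N powr \<kappa>) \<le> exp (- (real N powr \<zeta>))"
    by (rule eventually_compose_filterlim[OF _ filterlim_real_sequentially])
  then show ?thesis using eventually_ge_at_top[of 2]
  proof eventually_elim
    case (elim N)
    show ?case
    proof (intro ballI impI)
      fix k assume k: "k \<in> freqs \<eta> ?J" "k \<noteq> (\<lambda>j. 0)" "freq_norm \<eta> ?J k \<le> L * real N powr \<zeta>"
      let ?P = "(real m * (L * real N powr \<zeta>)) ^ m"
      have N: "0 < real N" using elim(2) by simp
      have "?P powr (- \<mu>) = (real m * L * real N powr \<zeta>) powr (real m * - \<mu>)"
        using m L N by (simp add: powr_powr powr_realpow [symmetric] mult.assoc)
      also have "\<dots> = (real m * L) powr (- (real m * \<mu>)) * real N powr (- (\<zeta> * (real m * \<mu>)))"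
        using m L N by (subst powr_mult) (auto simp: powr_powr)
      finally have "g * real N powr (- (\<zeta> * (real m * \<mu>))) \<le> cmod (1 - phase ?J k \<rho>)"
        using \<gamma>(2)[OF k(1,2) finite_freq_prod_le[OF k]] by (simp add: g_def mult.assoc)
      then have "real N * (g * real N powr (- (\<zeta> * (real m * \<mu>)))) \<le> real N * cmod (1 - phase ?J k \<rho>)"
        by (intro mult_left_mono) auto
      moreover have "real N * (g * real N powr (- (\<zeta> * (real m * \<mu>)))) = g * real N powr (1 - \<zeta> * (real m * \<mu>))"
        using N by (simp add: powr_diff powr_minus field_simps)
      ultimately have "(g * real N powr (1 - \<zeta> * (real m * \<mu>))) powr \<beta> \<le> (real N * cmod (1 - phase ?J k \<rho>)) powr \<beta>"
        using \<beta> g by (intro powr_mono2) auto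
      moreover have "(g * real N powr (1 - \<zeta> * (real m * \<mu>))) powr \<beta> = g powr \<beta> * real N powr \<kappa>"
        using g N by (subst powr_mult) (auto simp: powr_powr \<kappa>_def)
      ultimately have "g powr \<beta> * real N powr \<kappa> \<le> (real N * cmod (1 - phase ?J k \<rho>)) powr \<beta>" by simp
      then have "C * real N * exp (- c * (real N * cmod (1 - phase ?J k \<rho>)) powr \<beta>)
         \<le> C * real N * exp (- (c * g powr \<beta>) * real N powr \<kappa>)"
        using cC by (intro mult_left_mono) (auto simp: mult.assoc)
      then show "cmod (weighted_avg p q N (phase ?J k \<rho>)) \<le> exp (- (real N powr \<zeta>))"
        using cC(3)[OF elim(2) norm_phase, of ?J k \<rho>] elim(1) by linarith
    qed
  qed
qed

text \<open>
  For frequencies of norm \<open>\<Lambda> = O((ln N)^\<zeta>)\<close> the small divisor is at least a multiple of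
  \<open>exp (- 8 \<Lambda>^{1/(1+\<eta>)} ln \<Lambda>)\<close>. Since \<open>\<zeta> < 1 + \<eta>\<close> the exponent is \<open>o(ln N)\<close>, so the divisor
  eventually exceeds a multiple of \<open>N^{-1/2}\<close> and the average is at most
  \<open>C N exp (- c N^{\<beta>/2})\<close>, which is far below \<open>exp (- (ln N)^\<zeta>)\<close>.
\<close>

lemma infinite_dim_decay:
  fixes \<zeta> L :: real
  assumes pq: "0 < p" "0 < q" and J: "infinite J" and \<eta>: "1 \<le> \<eta>"
    and \<zeta>: "0 < \<zeta>" "\<zeta> < 1 + real \<eta>"
    and nr: "nonresonant \<eta> J \<rho>" and L: "0 < L"
  shows "\<forall>\<^sub>F N in sequentially. \<forall>k\<in>freqs \<eta> J. k \<noteq> (\<lambda>j. 0) \<longrightarrow>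
    freq_norm \<eta> J k \<le> L * ln (real N) powr \<zeta> \<longrightarrow>
    cmod (weighted_avg p q N (phase J k \<rho>)) \<le> exp (- (ln (real N) powr \<zeta>))"
proof -
  define \<beta> where "\<beta> = 1 / (1 + 1 / min p q)"
  have \<beta>: "0 < \<beta>" using pq by (simp add: \<beta>_def add_pos_pos)
  define a where "a = 1 / (1 + real \<eta>)"
  have a: "0 < a" "\<zeta> * a < 1" using \<zeta> by (auto simp: a_def)
  obtain \<gamma> where \<gamma>: "0 < \<gamma>" "\<And>k P. k \<in> freqs \<eta> J \<Longrightarrow> k \<noteq> (\<lambda>j. 0) \<Longrightarrow> freq_prod k \<le> P \<Longrightarrow>
       \<gamma> * P powr (- 2) \<le> cmod (1 - phase J k \<rho>)"
    \<comment> \<open>a larger Diophantine exponent only multiplies the logarithm of the divisor by a constant,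
      so \<open>n = 0\<close>, that is \<open>\<mu> = 2\<close>, will do\<close>
    using nonresonantE[OF nr, of 0] by (metis One_nat_def div_by_1 of_nat_1 one_add_one)
  obtain c C where cC: "0 < c" "0 < C" "\<And>N z. 2 \<le> N \<Longrightarrow> cmod z = 1 \<Longrightarrow>
     cmod (weighted_avg p q N z) \<le> C * real N * exp (- c * (real N * cmod (1 - z)) powr \<beta>)"
    using weighted_avg_decay[OF pq] unfolding \<beta>_def by metis
  \<comment> \<open>any exponent strictly between 0 and \<open>\<beta>/2\<close> separates the two rates\<close>
  define b where "b = \<beta> / 4"
  have b: "0 < b" using \<beta> by (simp add: b_def)
  have "\<forall>\<^sub>F x in at_top. 8 * (L * x powr \<zeta>) powr a * ln (L * x powr \<zeta>) \<le> x / 2"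
    using \<zeta>(1) a L by real_asymp
  then have "\<forall>\<^sub>F x in at_top. 8 * (L * ln x powr \<zeta>) powr a * ln (L * ln x powr \<zeta>) \<le> ln x / 2"
    by (rule eventually_compose_filterlim[OF _ ln_at_top])
  moreover have "\<forall>\<^sub>F x in at_top. ln x powr \<zeta> \<le> x powr b" using \<zeta>(1) b by real_asymp
  moreover have "\<forall>\<^sub>F x in at_top. C * x * exp (- (c * \<gamma> powr \<beta>) * x powr (\<beta> / 2)) \<le> exp (- (x powr b))"
    using b cC \<gamma>(1) \<beta> by (intro eventually_stretched_exp_le) (auto simp: b_def)
  ultimately have "\<forall>\<^sub>F x in at_top. 8 * (L * ln x powr \<zeta>) powr a * ln (L * ln x powr \<zeta>) \<le> ln x / 2 \<and>
      C * x * exp (- (c * \<gamma> powr \<beta>) * x powr (\<beta> / 2)) \<le> exp (- (ln x powr \<zeta>))"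
    by eventually_elim (auto elim: order_trans)
  then have "\<forall>\<^sub>F N in sequentially. 8 * (L * ln (real N) powr \<zeta>) powr a * ln (L * ln (real N) powr \<zeta>) \<le> ln (real N) / 2 \<and>
      C * real N * exp (- (c * \<gamma> powr \<beta>) * real N powr (\<beta> / 2)) \<le> exp (- (ln (real N) powr \<zeta>))"
    by (rule eventually_compose_filterlim[OF _ filterlim_real_sequentially])
  then show ?thesis using eventually_ge_at_top[of 2]
  proof eventually_elim
    case (elim N)
    show ?case
    proof (intro ballI impI)
      fix k assume k: "k \<in> freqs \<eta> J" "k \<noteq> (\<lambda>j. 0)" "freq_norm \<eta> J k \<le> L * ln (real N) powr \<zeta>"
      define \<Lambda> where "\<Lambda> = L * ln (real N) powr \<zeta>"
      have \<Lambda>: "1 \<le> \<Lambda>" using freq_norm_ge_1[OF k(1,2)] k(3) by (simp add: \<Lambda>_def)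
      have N: "0 < real N" using elim(2) by simp
      have "real N powr (- (1/2)) \<le> (\<Lambda> powr (4 * \<Lambda> powr a)) powr (- 2)"
      proof -
        have "8 * \<Lambda> powr a * ln \<Lambda> \<le> ln (real N) / 2" using elim(1) by (simp add: \<Lambda>_def)
        then have "exp (- (ln (real N) / 2)) \<le> exp (- (8 * \<Lambda> powr a * ln \<Lambda>))" by simp
        moreover have "exp (- (ln (real N) / 2)) = real N powr (- (1/2))" using N by (simp add: powr_def)
        moreover have "exp (- (8 * \<Lambda> powr a * ln \<Lambda>)) = (\<Lambda> powr (4 * \<Lambda> powr a)) powr (- 2)"
          unfolding powr_powr using \<Lambda> by (simp add: powr_def)
        ultimately show ?thesis by simp
      qed
      then have "\<gamma> * real N powr (- (1/2)) \<le> \<gamma> * (\<Lambda> powr (4 * \<Lambda> powr a)) powr (- 2)"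
        using \<gamma>(1) by (intro mult_left_mono) auto
      also have "\<dots> \<le> cmod (1 - phase J k \<rho>)"
        using \<gamma>(2)[OF k(1,2) infinite_freq_prod_le[OF k(1,2) J \<eta> k(3)]] by (simp add: \<Lambda>_def a_def)
      finally have "real N * (\<gamma> * real N powr (- (1/2))) \<le> real N * cmod (1 - phase J k \<rho>)"
        by (intro mult_left_mono) auto
      moreover have "real N * (\<gamma> * real N powr (- (1/2))) = \<gamma> * real N powr (1/2)"
      proof -
        have "real N * real N powr (- (1/2)) = real N powr (1 + - (1/2))"
          using N by (subst powr_add) simp
        then show ?thesis by simp
      qed
      ultimately have "(\<gamma> * real N powr (1/2)) powr \<beta> \<le> (real N * cmod (1 - phase J k \<rho>)) powr \<beta>"
        using \<beta> \<gamma>(1) by (intro powr_mono2) auto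
      moreover have "(\<gamma> * real N powr (1/2)) powr \<beta> = \<gamma> powr \<beta> * real N powr (\<beta> / 2)"
        using \<gamma>(1) N by (subst powr_mult) (auto simp: powr_powr)
      ultimately have "\<gamma> powr \<beta> * real N powr (\<beta> / 2) \<le> (real N * cmod (1 - phase J k \<rho>)) powr \<beta>" by simp
      then have "C * real N * exp (- c * (real N * cmod (1 - phase J k \<rho>)) powr \<beta>)
         \<le> C * real N * exp (- (c * \<gamma> powr \<beta>) * real N powr (\<beta> / 2))"
        using cC by (intro mult_left_mono) (auto simp: mult.assoc)
      then show "cmod (weighted_avg p q N (phase J k \<rho>)) \<le> exp (- (ln (real N) powr \<zeta>))"
        using cC(3)[OF elim(2) norm_phase, of J k \<rho>] elim(1) by linarith
    qed
  qed
qed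

section \<open>Exponential convergence\<close>

text \<open>
  A fixed frequency is the case of a constant sequence \<open>S\<close>, which is \<open>o(\<phi>)\<close> because \<open>\<phi>\<close> tends
  to infinity.
\<close>

lemma error_rates:
  fixes \<phi> :: "nat \<Rightarrow> real" and K :: "(int \<Rightarrow> real) \<Rightarrow> 'i \<Rightarrow> real"
  assumes pq: "0 < p" "0 < q" and K: "torus_analytic \<eta> J K"
    and F: "\<And>\<theta>. F (K \<theta>) = K (\<lambda>j. \<theta> j + \<rho> j)"
    and \<phi>: "\<And>N. 0 \<le> \<phi> N" "filterlim \<phi> at_top sequentially"
    and R: "\<And>L. 0 < L \<Longrightarrow> \<forall>\<^sub>F N in sequentially. \<forall>k\<in>freqs \<eta> J. k \<noteq> (\<lambda>j. 0) \<longrightarrow>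
        freq_norm \<eta> J k \<le> L * \<phi> N \<longrightarrow> cmod (weighted_avg p q N (phase J k \<rho>)) \<le> exp (- \<phi> N)"
  shows "(\<forall>s\<in>freqs \<eta> J. \<exists>C::real. \<forall>N\<ge>2. \<forall>\<theta>.
          fourier_error p q J K F \<rho> N s \<theta> \<le> ennreal (C * exp (- \<phi> N))) \<and>
       (\<forall>S :: nat \<Rightarrow> real. (\<forall>N. 0 \<le> S N) \<and> S \<in> o(\<phi>) \<longrightarrow>
          (\<exists>C::real. \<forall>N\<ge>2. \<forall>s\<in>freqs \<eta> J. freq_norm \<eta> J s \<le> S N \<longrightarrow> (\<forall>\<theta>.
             fourier_error p q J K F \<rho> N s \<theta> \<le> ennreal (C * exp (- \<phi> N)))))"
proof (intro conjI ballI allI impI)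
  fix s assume s: "s \<in> freqs \<eta> J"
  have "(\<lambda>_. freq_norm \<eta> J s) \<in> o(\<phi>)"
  proof (rule landau_o.smallI)
    fix c :: real assume c: "0 < c"
    have "\<forall>\<^sub>F N in sequentially. freq_norm \<eta> J s / c \<le> \<phi> N"
      using \<phi>(2) unfolding filterlim_at_top by blast
    then show "\<forall>\<^sub>F N in sequentially. norm (freq_norm \<eta> J s) \<le> c * norm (\<phi> N)"
      by eventually_elim (use c \<phi>(1) freq_norm_nonneg[OF s] in \<open>simp add: pos_divide_le_eq mult.commute\<close>)
  qed
  then obtain C where C: "\<forall>N\<ge>2. \<forall>s'\<in>freqs \<eta> J. freq_norm \<eta> J s' \<le> freq_norm \<eta> J s \<longrightarrow>
    (\<forall>\<theta>. fourier_error p q J K F \<rho> N s' \<theta> \<le> ennreal (C * exp (- \<phi> N)))"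
    using error_rate[OF pq K F \<phi>(1) R freq_norm_nonneg[OF s]] by blast
  then show "\<exists>C::real. \<forall>N\<ge>2. \<forall>\<theta>. fourier_error p q J K F \<rho> N s \<theta> \<le> ennreal (C * exp (- \<phi> N))"
    using s by blast
next
  fix S :: "nat \<Rightarrow> real" assume "(\<forall>N. 0 \<le> S N) \<and> S \<in> o(\<phi>)"
  then show "\<exists>C::real. \<forall>N\<ge>2. \<forall>s\<in>freqs \<eta> J. freq_norm \<eta> J s \<le> S N \<longrightarrow> (\<forall>\<theta>.
             fourier_error p q J K F \<rho> N s \<theta> \<le> ennreal (C * exp (- \<phi> N)))"
    using error_rate[OF pq K F \<phi>(1) R] by blast
qed

lemma vanishing_of_rate:
  fixes C :: real and \<phi> :: "nat \<Rightarrow> real" and e :: "nat \<Rightarrow> 'b \<Rightarrow> ennreal"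
  assumes "\<forall>N\<ge>2. \<forall>\<theta>. e N \<theta> \<le> ennreal (C * exp (- \<phi> N))" "filterlim \<phi> at_top sequentially" "0 < \<epsilon>"
  shows "\<exists>N0. \<forall>N\<ge>N0. \<forall>\<theta>. e N \<theta> \<le> ennreal \<epsilon>"
proof -
  have "((\<lambda>N. C * exp (- \<phi> N)) \<longlongrightarrow> C * 0) sequentially"
    by (intro tendsto_intros filterlim_compose[OF exp_at_bot] filterlim_compose[OF filterlim_uminus_at_bot_at_top] assms(2))
  then have "\<forall>\<^sub>F N in sequentially. C * exp (- \<phi> N) < \<epsilon>"
    using assms(3) by (intro order_tendstoD(2)) auto
  then have "\<forall>\<^sub>F N in sequentially. \<forall>\<theta>. e N \<theta> \<le> ennreal \<epsilon>"
    using eventually_ge_at_top[of 2]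
    by eventually_elim (use assms(1) in \<open>meson ennreal_leI less_imp_le order_trans\<close>)
  then show ?thesis by (simp add: eventually_sequentially)
qed

theorem theorem1p4:
  fixes d :: enat and J :: "int set" and \<eta> :: nat and p q :: real
    and K :: "(int \<Rightarrow> real) \<Rightarrow> 'D::countable \<Rightarrow> real"
  assumes "torus_index d J" and "2 \<le> \<eta>" and "0 < p" and "0 < q"
    and "torus_analytic \<eta> J K"
  shows "AE \<rho> in rotation_measure J. \<forall>\<Omega> F.
    diffeomorphism_of \<Omega> F \<and> range K \<subseteq> \<Omega> \<and> F ` range K = range K \<and>
    (\<forall>\<theta>. F (K \<theta>) = K (\<lambda>j. \<theta> j + \<rho> j)) \<longrightarrow>
    (\<forall>s\<in>freqs \<eta> J. \<forall>\<epsilon>::real. \<epsilon> > 0 \<longrightarrow>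
       (\<exists>N0. \<forall>N\<ge>N0. \<forall>\<theta>. fourier_error p q J K F \<rho> N s \<theta> \<le> ennreal \<epsilon>)) \<and>
    (\<forall>m. d = enat m \<longrightarrow> (\<forall>\<zeta>::real. 0 < \<zeta> \<and> \<zeta> < inverse (real m + 1 + 1 / min p q) \<longrightarrow>
       (\<forall>s\<in>freqs \<eta> J. \<exists>C::real. \<forall>N\<ge>2. \<forall>\<theta>.
          fourier_error p q J K F \<rho> N s \<theta> \<le> ennreal (C * exp (- (real N powr \<zeta>)))) \<and>
       (\<forall>S :: nat \<Rightarrow> real. (\<forall>N. 0 \<le> S N) \<and> S \<in> o(\<lambda>N. real N powr \<zeta>) \<longrightarrow>
          (\<exists>C::real. \<forall>N\<ge>2. \<forall>s\<in>freqs \<eta> J. l1_norm J s \<le> S N \<longrightarrow> (\<forall>\<theta>.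
             fourier_error p q J K F \<rho> N s \<theta> \<le> ennreal (C * exp (- (real N powr \<zeta>)))))))) \<and>
    (d = \<infinity> \<longrightarrow> (\<forall>\<zeta>::real. 2 \<le> \<zeta> \<and> \<zeta> < 1 + real \<eta> \<longrightarrow>
       (\<forall>s\<in>freqs \<eta> J. \<exists>C::real. \<forall>N\<ge>2. \<forall>\<theta>.
          fourier_error p q J K F \<rho> N s \<theta> \<le> ennreal (C * exp (- (ln (real N) powr \<zeta>)))) \<and>
       (\<forall>S :: nat \<Rightarrow> real. (\<forall>N. 0 \<le> S N) \<and> S \<in> o(\<lambda>N. ln (real N) powr \<zeta>) \<longrightarrow>
          (\<exists>C::real. \<forall>N\<ge>2. \<forall>s\<in>freqs \<eta> J. eta_norm \<eta> J s \<le> S N \<longrightarrow> (\<forall>\<theta>.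
             fourier_error p q J K F \<rho> N s \<theta> \<le> ennreal (C * exp (- (ln (real N) powr \<zeta>))))))))"
  using AE_rotation_nonresonant[OF assms(1), of \<eta>]
proof eventually_elim
  case (elim \<rho>)
  have fin: "(\<forall>s\<in>freqs \<eta> J. \<exists>C::real. \<forall>N\<ge>2. \<forall>\<theta>.
          fourier_error p q J K F \<rho> N s \<theta> \<le> ennreal (C * exp (- (real N powr \<zeta>)))) \<and>
       (\<forall>S :: nat \<Rightarrow> real. (\<forall>N. 0 \<le> S N) \<and> S \<in> o(\<lambda>N. real N powr \<zeta>) \<longrightarrow>
          (\<exists>C::real. \<forall>N\<ge>2. \<forall>s\<in>freqs \<eta> J. l1_norm J s \<le> S N \<longrightarrow> (\<forall>\<theta>.
             fourier_error p q J K F \<rho> N s \<theta> \<le> ennreal (C * exp (- (real N powr \<zeta>))))))"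
    if F: "\<forall>\<theta>. F (K \<theta>) = K (\<lambda>j. \<theta> j + \<rho> j)" and d: "d = enat m"
      and \<zeta>: "0 < \<zeta>" "\<zeta> < inverse (real m + 1 + 1 / min p q)" for F m \<zeta>
  proof -
    have J: "1 \<le> m" "J = {1..int m}" using assms(1) d by (auto simp: torus_index_def)
    have "freq_norm \<eta> J s = l1_norm J s" for s by (simp add: freq_norm_def J(2))
    moreover have "filterlim (\<lambda>N. real N powr \<zeta>) at_top sequentially"
      using \<zeta>(1) by real_asymp
    ultimately show ?thesis
      using error_rates[OF assms(3,4,5), of F \<rho> "\<lambda>N. real N powr \<zeta>"] F
        finite_dim_decay[OF assms(3,4) J(1) \<zeta>, of \<eta> \<rho>] elim unfolding J(2) by simp
  qed
  have inf: "(\<forall>s\<in>freqs \<eta> J. \<exists>C::real. \<forall>N\<ge>2. \<forall>\<theta>.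
          fourier_error p q J K F \<rho> N s \<theta> \<le> ennreal (C * exp (- (ln (real N) powr \<zeta>)))) \<and>
       (\<forall>S :: nat \<Rightarrow> real. (\<forall>N. 0 \<le> S N) \<and> S \<in> o(\<lambda>N. ln (real N) powr \<zeta>) \<longrightarrow>
          (\<exists>C::real. \<forall>N\<ge>2. \<forall>s\<in>freqs \<eta> J. eta_norm \<eta> J s \<le> S N \<longrightarrow> (\<forall>\<theta>.
             fourier_error p q J K F \<rho> N s \<theta> \<le> ennreal (C * exp (- (ln (real N) powr \<zeta>))))))"
    if F: "\<forall>\<theta>. F (K \<theta>) = K (\<lambda>j. \<theta> j + \<rho> j)" and d: "d = \<infinity>"
      and \<zeta>: "0 < \<zeta>" "\<zeta> < 1 + real \<eta>" for F \<zeta>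
  proof -
    have J: "infinite J" using assms(1) d by (auto simp: torus_index_def infinite_Ici infinite_UNIV_int)
    have "freq_norm \<eta> J s = eta_norm \<eta> J s" for s using J by (simp add: freq_norm_def)
    moreover have "filterlim (\<lambda>N. ln (real N) powr \<zeta>) at_top sequentially"
      using \<zeta>(1) by real_asymp
    ultimately show ?thesis
      using error_rates[OF assms(3,4,5), of F \<rho> "\<lambda>N. ln (real N) powr \<zeta>"] F
        infinite_dim_decay[OF assms(3,4) J _ \<zeta> elim] assms(2) by simp
  qed
  have van: "\<exists>N0. \<forall>N\<ge>N0. \<forall>\<theta>. fourier_error p q J K F \<rho> N s \<theta> \<le> ennreal \<epsilon>"
    if F: "\<forall>\<theta>. F (K \<theta>) = K (\<lambda>j. \<theta> j + \<rho> j)" and s: "s \<in> freqs \<eta> J" and \<epsilon>: "0 < \<epsilon>" for F s \<epsilon>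
  proof (cases d)
    case (enat m)
    \<comment> \<open>any admissible rate shows that the error vanishes\<close>
    define \<zeta> where "\<zeta> = inverse (real m + 1 + 1 / min p q) / 2"
    have "0 < inverse (real m + 1 + 1 / min p q)" using assms(3,4) by (simp add: add_nonneg_pos add_pos_pos)
    then have \<zeta>: "0 < \<zeta>" "\<zeta> < inverse (real m + 1 + 1 / min p q)" by (auto simp: \<zeta>_def)
    obtain C where "\<forall>N\<ge>2. \<forall>\<theta>. fourier_error p q J K F \<rho> N s \<theta> \<le> ennreal (C * exp (- (real N powr \<zeta>)))"
      using fin[OF F enat \<zeta>] s by blast
    moreover have "filterlim (\<lambda>N. real N powr \<zeta>) at_top sequentially" using \<zeta>(1) by real_asymp
    ultimately show ?thesis using \<epsilon> by (rule vanishing_of_rate)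
  next
    case infinity
    obtain C where "\<forall>N\<ge>2. \<forall>\<theta>. fourier_error p q J K F \<rho> N s \<theta> \<le> ennreal (C * exp (- (ln (real N) powr 1)))"
      using inf[OF F infinity, of 1] s assms(2) by fastforce
    moreover have "filterlim (\<lambda>N. ln (real N) powr 1) at_top sequentially" by real_asymp
    ultimately show ?thesis using \<epsilon> by (rule vanishing_of_rate)
  qed
  show ?case
  proof (intro allI impI, goal_cases)
    case (1 \<Omega> F)
    then have F: "\<forall>\<theta>. F (K \<theta>) = K (\<lambda>j. \<theta> j + \<rho> j)" by blast
    show ?case
    proof (intro conjI[OF _ conjI], goal_cases)
      case 1
      then show ?case using van[OF F] by blast
    next
      case 2
      then show ?case by (intro allI impI fin[OF F]) auto
    next
      case 3
      then show ?case by (intro allI impI inf[OF F]) auto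
    qed
  qed
qed

end
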